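(* Let $\Omega\subset\mathbb R^n$ be a domain, $u\in C^2(\Omega)$, and let $L=\{(x,\nabla u(x)):x\in\Omega\}\subset\mathbb R^n\oplus i\mathbb R^n=\mathbb C^n$ be the graph of the gradient of $u$, oriented by $\Omega$. Then the function $$\theta(x)=\mathrm{tr}\{\arctan D_x^2u\},$$ considered as a function on $L$, is the phase function for $L$. Thus its gradient is related to the mean curvature vector field $H$ of $L$ by $$\nabla\theta=-JH\quad\text{on }L.$$ Otherwise said, if $u$ is a solution of $\mathrm{tr}\{\arctan(D_x^2u)\}=\psi(x)$ on $\Omega$ with $\psi$ smooth, then $\nabla\widetilde\psi=-JH$ on $L$, where $\widetilde\psi$ is the pull-back of $\psi$ to $L$.
   Context: Coordinates on $\mathbb C^n=\mathbb R^n\oplus i\mathbb R^n$ are $z=x+iy$, with the Euclidean metric $\langle\cdot,\cdot\rangle$, and $J$ is the complex structure (multiplication by $i$). The graph $L$ of $\nabla u$ is a Lagrangian submanifold, with the induced metric. The phase function of an oriented Lagrangian submanifold $L$ is the function $\theta$ (defined modulo $2\pi$) determined by $dz_1\wedge\dots\wedge dz_n|_L=e^{i\theta}\,d\mathrm{vol}_L$. $\nabla\theta$ is the gradient of $\theta$ on $L$ with respect to the induced metric. The mean curvature vector field is $H=\sum_kB_{e_k,e_k}$, the trace of the second fundamental form $B_{V,W}=(\nabla_VW)^{\mathrm{normal}}$ over a local orthonormal tangent frame $e_1,\dots,e_n$ of $L$. The pull-back $\widetilde\psi$ is taken under the projection $L\to\Omega$, $(x,\nabla u(x))\mapsto x$.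 $\mathrm{tr}\{\arctan A\}$ is the sum of the arctangents of the eigenvalues of the symmetric matrix $A$.
   Formalization: For u only C², H and the gradient of θ need not exist (n = 1, u'' = |x| at 0), so both identities with −JH are stated at every point of L where H exists; H is shown to exist uniquely where D²u is differentiable. *)

theory Defs
  imports "HOL-Analysis.Analysis"
begin

section \<open>Calculus on open subsets of Euclidean space\<close>

definition partial :: "'n::finite \<Rightarrow> (real^'n \<Rightarrow> real) \<Rightarrow> real^'n \<Rightarrow> real" where
  "partial i f x = frechet_derivative f (at x) (axis i 1)"

text \<open>The class \<open>C\<^sup>k(\<Omega>)\<close>, for open \<open>\<Omega>\<close>.\<close>

primrec C_k_on :: "nat \<Rightarrow> (real^'n::finite \<Rightarrow> real) \<Rightarrow> (real^'n) set \<Rightarrow> bool" where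
  "C_k_on 0 f \<Omega> \<longleftrightarrow> continuous_on \<Omega> f"
| "C_k_on (Suc k) f \<Omega> \<longleftrightarrow> f differentiable_on \<Omega> \<and> (\<forall>i. C_k_on k (partial i f) \<Omega>)"

definition smooth_on :: "(real^'n::finite \<Rightarrow> real) \<Rightarrow> (real^'n) set \<Rightarrow> bool" where
  "smooth_on f \<Omega> \<longleftrightarrow> (\<forall>k. C_k_on k f \<Omega>)"

definition gradient :: "(real^'n::finite \<Rightarrow> real) \<Rightarrow> real^'n \<Rightarrow> real^'n" where
  "gradient u x = (\<chi> i. partial i u x)"

definition hessian :: "(real^'n::finite \<Rightarrow> real) \<Rightarrow> real^'n \<Rightarrow> real^'n^'n" where
  "hessian u x = (\<chi> i j. partial i (partial j u) x)"

text \<open>The sum of \<open>arctan c\<close> over the eigenvalues \<open>c\<close> of \<open>A\<close>, counted with multiplicity. It is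
  meant for symmetric \<open>A\<close>, for which the multiplicity of an eigenvalue is the dimension of its
  eigenspace.\<close>

definition tr_arctan :: "real^'n^'n::finite \<Rightarrow> real" where
  "tr_arctan A = (\<Sum>c | \<exists>v. v \<noteq> 0 \<and> A *v v = c *\<^sub>R v. real (dim {v. A *v v = c *\<^sub>R v}) * arctan c)"


section \<open>Submanifolds of complex n-space\<close>

text \<open>\<open>complex^'n\<close> carries the Euclidean inner product \<open>\<Sum>k. Re (z$k) * Re (w$k) + Im (z$k) * Im (w$k)\<close>;
  \<open>subspace\<close>, \<open>span\<close> and derivatives are over the reals.\<close>

definition cJ :: "complex^'n::finite \<Rightarrow> complex^'n" where
  "cJ z = (\<chi> k. \<i> * z $ k)"

definition tangent_space :: "'a::euclidean_space set \<Rightarrow> 'a \<Rightarrow> 'a set" where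
  "tangent_space L p = {v. \<exists>\<gamma> \<epsilon>. 0 < \<epsilon> \<and> \<gamma> 0 = p \<and> (\<forall>t\<in>{-\<epsilon><..<\<epsilon>}. \<gamma> t \<in> L)
      \<and> (\<gamma> has_vector_derivative v) (at (0::real))}"

definition orthonormal_frame :: "'a::euclidean_space set \<Rightarrow> ('n::finite \<Rightarrow> 'a) \<Rightarrow> bool" where
  "orthonormal_frame T e \<longleftrightarrow> (\<forall>j k. e j \<bullet> e k = (if j = k then 1 else 0)) \<and> span (range e) = T"

text \<open>\<open>is_gradient_at L f p g\<close>: \<open>g\<close> is the gradient at \<open>p\<close> of \<open>f|L\<close> in the induced metric. The values
  of \<open>f\<close> off \<open>L\<close> are irrelevant. The derivative within \<open>L\<close> is determined only along the tangent
  space, so \<open>g\<close> is unique because it is required to be tangent.\<close>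

definition is_gradient_at ::
  "'a::euclidean_space set \<Rightarrow> ('a \<Rightarrow> real) \<Rightarrow> 'a \<Rightarrow> 'a \<Rightarrow> bool" where
  "is_gradient_at L f p g \<longleftrightarrow>
     g \<in> tangent_space L p \<and> (f has_derivative (\<lambda>v. g \<bullet> v)) (at p within L)"

definition normal_part :: "'a::euclidean_space set \<Rightarrow> 'a \<Rightarrow> 'a" where
  "normal_part T w = (THE y. y \<in> orthogonal_comp T \<and> w - y \<in> T)"

text \<open>The value at \<open>p\<close> of \<open>B\<^sub>V\<^sub>,\<^sub>W\<close>, where \<open>V\<close> is a tangent vector at \<open>p\<close> and \<open>W\<close> is a tangent field on \<open>L\<close>
  near \<open>p\<close>, differentiable at \<open>p\<close>. \<open>\<nabla>\<^sub>VW\<close> is the derivative of \<open>W\<close> along \<open>L\<close> in the flat ambient space,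
  which is well defined since \<open>V\<close> is tangent.\<close>

definition second_fundamental_form ::
  "'a::euclidean_space set \<Rightarrow> 'a \<Rightarrow> 'a \<Rightarrow> ('a \<Rightarrow> 'a) \<Rightarrow> 'a" where
  "second_fundamental_form L p V W =
     normal_part (tangent_space L p) (frechet_derivative W (at p within L) V)"

text \<open>\<open>H\<close> is the mean curvature vector at \<open>p\<close> of an n-dimensional submanifold \<open>L\<close> of complex n-space.
  It exists only where \<open>L\<close> is regular enough to have a tangent frame that is differentiable at \<open>p\<close>.\<close>

definition is_mean_curvature_at ::
  "(complex^'n::finite) set \<Rightarrow> complex^'n \<Rightarrow> complex^'n \<Rightarrow> bool" where
  "is_mean_curvature_at L p H \<longleftrightarrow>
     (\<exists>U (e :: 'n \<Rightarrow> complex^'n \<Rightarrow> complex^'n).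
        open U \<and> p \<in> U
      \<and> (\<forall>q\<in>L \<inter> U. orthonormal_frame (tangent_space L q) (\<lambda>k. e k q))
      \<and> (\<forall>k. e k differentiable (at p within L))
      \<and> H = (\<Sum>k\<in>UNIV. second_fundamental_form L p (e k p) (e k)))"

text \<open>\<open>dz\<^sub>1 \<and> \<dots> \<and> dz\<^sub>n\<close> evaluated on \<open>n\<close> vectors. Coordinates and vectors share the index type \<open>'n\<close>,
  so the value does not depend on how \<open>'n\<close> is enumerated.\<close>

definition dz_form :: "('n::finite \<Rightarrow> complex^'n) \<Rightarrow> complex" where
  "dz_form v = det (\<chi> j k. v j $ k)"

text \<open>The volume form of the tangent space \<open>T\<close>, where \<open>Pos\<close> is the set of its positively oriented
  bases. It is independent of the chosen positively oriented orthonormal basis \<open>e\<close>.\<close>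

definition volume_form ::
  "'a::euclidean_space set \<Rightarrow> ('n::finite \<Rightarrow> 'a) set \<Rightarrow> ('n \<Rightarrow> 'a) \<Rightarrow> real" where
  "volume_form T Pos v =
     (let e = (SOME e. orthonormal_frame T e \<and> e \<in> Pos) in det (\<chi> j k. v j \<bullet> e k))"

text \<open>An oriented submanifold is given by its point set \<open>L\<close> and, for every point \<open>p\<close>, the set \<open>Or p\<close> of
  positively oriented bases of the tangent space at \<open>p\<close>. A phase function is a real representative
  of the angle, which is defined modulo \<open>2\<pi>\<close>.\<close>

definition phase_function ::
  "(complex^'n::finite) set \<Rightarrow> (complex^'n \<Rightarrow> ('n \<Rightarrow> complex^'n) set) \<Rightarrow> (complex^'n \<Rightarrow> real) \<Rightarrow> bool" where
  "phase_function L Or \<theta> \<longleftrightarrow>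
     (\<forall>p\<in>L. \<forall>v :: 'n \<Rightarrow> complex^'n. (\<forall>j. v j \<in> tangent_space L p) \<longrightarrow>
        dz_form v = exp (\<i> * of_real (\<theta> p)) * of_real (volume_form (tangent_space L p) (Or p) v))"


section \<open>Gradient graphs\<close>

definition re_part :: "complex^'n::finite \<Rightarrow> real^'n" where
  "re_part z = (\<chi> k. Re (z $ k))"

definition graph_point :: "(real^'n::finite \<Rightarrow> real) \<Rightarrow> real^'n \<Rightarrow> complex^'n" where
  "graph_point u x = (\<chi> k. Complex (x $ k) (gradient u x $ k))"

definition gradient_graph :: "(real^'n::finite \<Rightarrow> real) \<Rightarrow> (real^'n) set \<Rightarrow> (complex^'n) set" where
  "gradient_graph u \<Omega> = graph_point u ` \<Omega>"

text \<open>The orientation of the graph for which the projection to \<open>\<Omega>\<close> preserves orientation.\<close>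

definition graph_orientation ::
  "(real^'n::finite \<Rightarrow> real) \<Rightarrow> (real^'n) set \<Rightarrow> complex^'n \<Rightarrow> ('n \<Rightarrow> complex^'n) set" where
  "graph_orientation u \<Omega> p =
     {v. (\<forall>j. v j \<in> tangent_space (gradient_graph u \<Omega>) p) \<and> 0 < det (\<chi> j k. re_part (v j) $ k)}"

text \<open>The function on the graph obtained from a function on \<open>\<Omega>\<close> by the projection.\<close>

definition graph_pullback :: "(real^'n::finite \<Rightarrow> real) \<Rightarrow> complex^'n \<Rightarrow> real" where
  "graph_pullback \<psi> = \<psi> \<circ> re_part"

end

theory Submission
  imports Defs
begin

text \<open>The tangent space of the graph at \<open>(x, \<nabla>u(x))\<close> is the image of \<open>1 + iA\<close>, where \<open>A\<close> is the
  Hessian of \<open>u\<close> at \<open>x\<close>. Diagonalising \<open>A\<close> gives \<open>det (1 + iA) = r e\<^sup>i\<^sup>\<theta>\<close> with \<open>\<theta> = tr (arctan A)\<close> and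
  \<open>r\<^sup>2 = det (1 + A\<^sup>2)\<close>, which is the Gram determinant; so \<open>\<theta>\<close> is the phase.

  An orthonormal tangent frame is \<open>e\<^sub>k = (1 + iA) E\<^sub>k\<close> with \<open>\<Sum>k. E\<^sub>k E\<^sub>k\<^sup>T = (1 + A\<^sup>2)\<^sup>-\<^sup>1\<close>. If the frame is
  differentiable at a point then so is \<open>A\<close>, because the imaginary part of \<open>e\<^sub>k\<close> is \<open>A E\<^sub>k\<close>. Up to tangent
  vectors the derivative of \<open>e\<^sub>k\<close> in the direction \<open>(1 + iA) h\<close> is \<open>i (D\<^sub>hA) E\<^sub>k\<close>, hence
  \<open>\<langle>H, J (1 + iA) h\<rangle> = \<Sum>k. \<langle>(DA[E\<^sub>k]) E\<^sub>k, h\<rangle>\<close>. On the other hand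
  \<open>D\<^sub>h\<theta> = tr ((1 + A\<^sup>2)\<^sup>-\<^sup>1 D\<^sub>hA) = \<Sum>k. \<langle>(D\<^sub>hA) E\<^sub>k, E\<^sub>k\<rangle>\<close>. The two agree since \<open>DA\<close> is a totally
  symmetric trilinear form; this needs only the differentiability of \<open>A\<close> at the single point.\<close>

section \<open>Symmetric second derivatives and the spectral theorem\<close>

text \<open>The mean value theorem along \<open>b\<close> turns the second difference into
  \<open>t\<close> times an increment of \<open>g\<close> paired with \<open>b\<close>; expanding
  \<open>g\<close> about \<open>x\<close> then gives the main term and an error of order
  o(\<open>t\<^sup>2\<close>). The derivative of \<open>g\<close> enters at the single point
  \<open>x\<close>, which is all that is available later for the Hessian.\<close>

lemma second_difference_bound:
  fixes f :: "'a::euclidean_space \<Rightarrow> real"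
  assumes N: "open N" "x \<in> N"
    and f: "\<And>y. y \<in> N \<Longrightarrow> (f has_derivative (\<lambda>h. g y \<bullet> h)) (at y)"
    and g: "(g has_derivative g') (at x)" and "0 < e"
  shows "\<exists>d>0. \<forall>t. 0 < t \<and> t < d \<longrightarrow>
    \<bar>(f (x + t *\<^sub>R a + t *\<^sub>R b) - f (x + t *\<^sub>R a) - f (x + t *\<^sub>R b) + f x) - t\<^sup>2 * (g' a \<bullet> b)\<bar> \<le> e * t\<^sup>2"
proof -
  \<comment> \<open>The error is bounded below by \<open>e / ?c\<close> times
    \<open>?c * t\<^sup>2\<close> from above; the added ones keep \<open>?c\<close> positive when
    \<open>a\<close> or \<open>b\<close> is zero.\<close>
  let ?c = "(2 * norm a + 2 * norm b + 1) * (norm b + 1)"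
  have c: "0 < ?c"
    by (intro mult_pos_pos add_nonneg_pos add_nonneg_nonneg) auto
  then have e: "0 < e / ?c" using \<open>0 < e\<close> by simp
  obtain d1 where d1: "0 < d1" "\<And>y. norm (y - x) < d1 \<Longrightarrow> norm (g y - g x - g' (y - x)) \<le> e / ?c * norm (y - x)"
    using g e unfolding has_derivative_at_alt by meson
  obtain d2 where d2: "0 < d2" "ball x d2 \<subseteq> N"
    using N openE by blast
  let ?m = "norm a + norm b + 1"
  have m: "0 < ?m" by (simp add: add_nonneg_pos)
  have lin: "linear g'" using g has_derivative_linear by blast
  show ?thesis
  proof (intro exI[of _ "min d1 d2 / ?m"] conjI allI impI)
    show "0 < min d1 d2 / ?m" using d1 d2 m by simp
    fix t :: real assume t: "0 < t \<and> t < min d1 d2 / ?m"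
    then have tm: "t * ?m < min d1 d2" using m by (simp add: field_simps)
    have near: "norm (r *\<^sub>R a + s *\<^sub>R b) < min d1 d2" if "0 \<le> r" "r \<le> t" "0 \<le> s" "s \<le> t" for r s
    proof -
      have "norm (r *\<^sub>R a + s *\<^sub>R b) \<le> r * norm a + s * norm b"
        using norm_triangle_ineq[of "r *\<^sub>R a" "s *\<^sub>R b"] that by simp
      also have "\<dots> \<le> t * norm a + t * norm b"
        using that by (intro add_mono mult_right_mono) auto
      also have "\<dots> \<le> t * ?m" using t by (simp add: algebra_simps)
      finally show ?thesis using tm by simp
    qed
    have inN: "x + r *\<^sub>R a + s *\<^sub>R b \<in> N" if "0 \<le> r" "r \<le> t" "0 \<le> s" "s \<le> t" for r s
    proof -
      have "dist x (x + (r *\<^sub>R a + s *\<^sub>R b)) < d2" by (metis add_diff_cancel_left' dist_commute dist_norm min_less_iff_conj near that)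
      then show ?thesis using d2 by (auto simp: add.assoc mem_ball)
    qed
    define \<phi> where "\<phi> s = f (x + t *\<^sub>R a + s *\<^sub>R b) - f (x + s *\<^sub>R b)" for s
    have D: "(\<phi> has_real_derivative ((g (x + t *\<^sub>R a + s *\<^sub>R b) - g (x + s *\<^sub>R b)) \<bullet> b)) (at s)"
      if "0 \<le> s" "s \<le> t" for s
    proof -
      have 1: "((\<lambda>s. f (x + t *\<^sub>R a + s *\<^sub>R b)) has_derivative (\<lambda>h. g (x + t *\<^sub>R a + s *\<^sub>R b) \<bullet> (h *\<^sub>R b))) (at s)"
        by (rule has_derivative_compose[where g = f and f = "\<lambda>s. x + t *\<^sub>R a + s *\<^sub>R b", OF _ f[OF inN]])
          (use that t in \<open>auto intro!: derivative_eq_intros\<close>)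
      have "((\<lambda>s. f (x + 0 *\<^sub>R a + s *\<^sub>R b)) has_derivative (\<lambda>h. g (x + 0 *\<^sub>R a + s *\<^sub>R b) \<bullet> (h *\<^sub>R b))) (at s)"
        by (rule has_derivative_compose[where g = f and f = "\<lambda>s. x + 0 *\<^sub>R a + s *\<^sub>R b", OF _ f[OF inN]])
          (use that t in \<open>auto intro!: derivative_eq_intros\<close>)
      then have 2: "((\<lambda>s. f (x + s *\<^sub>R b)) has_derivative (\<lambda>h. g (x + s *\<^sub>R b) \<bullet> (h *\<^sub>R b))) (at s)"
        by simp
      show ?thesis
        unfolding has_field_derivative_def \<phi>_def
        by (rule has_derivative_eq_rhs[OF has_derivative_diff[OF 1 2]]) (auto simp: fun_eq_iff algebra_simps)
    qed
    obtain s where s: "0 < s" "s < t" "\<phi> t - \<phi> 0 = t * ((g (x + t *\<^sub>R a + s *\<^sub>R b) - g (x + s *\<^sub>R b)) \<bullet> b)"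
      using MVT2[of 0 t \<phi> "\<lambda>s. (g (x + t *\<^sub>R a + s *\<^sub>R b) - g (x + s *\<^sub>R b)) \<bullet> b"] D t by auto
    \<comment> \<open>Both values of \<open>g\<close> are expanded about \<open>x\<close>, the only
      point where \<open>g\<close> is known to be differentiable; the terms
      \<open>g' (s *\<^sub>R b)\<close> cancel in the difference.\<close>
    define R1 where "R1 = g (x + t *\<^sub>R a + s *\<^sub>R b) - g x - g' (t *\<^sub>R a + s *\<^sub>R b)"
    define R2 where "R2 = g (x + s *\<^sub>R b) - g x - g' (s *\<^sub>R b)"
    have nb: "norm (t *\<^sub>R a + s *\<^sub>R b) \<le> t * (norm a + norm b)" "norm (s *\<^sub>R b) \<le> t * (norm a + norm b)"
    proof -
      have "s * norm b \<le> t * norm b" using s by (intro mult_right_mono) auto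
      moreover have "norm (t *\<^sub>R a + s *\<^sub>R b) \<le> t * norm a + s * norm b"
        using norm_triangle_ineq[of "t *\<^sub>R a" "s *\<^sub>R b"] s t by simp
      moreover have "0 \<le> t * norm a" using t by simp
      ultimately show "norm (t *\<^sub>R a + s *\<^sub>R b) \<le> t * (norm a + norm b)" "norm (s *\<^sub>R b) \<le> t * (norm a + norm b)"
        unfolding distrib_left norm_scaleR abs_of_pos[OF s(1)] by linarith+
    qed
    have "norm R1 \<le> e / ?c * norm (t *\<^sub>R a + s *\<^sub>R b)"
      using d1(2)[of "x + t *\<^sub>R a + s *\<^sub>R b"] near[of t s] s t by (simp add: R1_def add.assoc)
    also have "\<dots> \<le> e / ?c * (t * (norm a + norm b))"
      using nb e by (intro mult_left_mono) auto
    finally have R1: "norm R1 \<le> e / ?c * (t * (norm a + norm b))" .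
    have "norm R2 \<le> e / ?c * norm (s *\<^sub>R b)"
      using d1(2)[of "x + s *\<^sub>R b"] near[of 0 s] s t by (simp add: R2_def)
    also have "\<dots> \<le> e / ?c * (t * (norm a + norm b))"
      using nb e by (intro mult_left_mono) auto
    finally have R2: "norm R2 \<le> e / ?c * (t * (norm a + norm b))" .
    have "norm (R1 - R2) \<le> e / ?c * (t * (2 * norm a + 2 * norm b))"
    proof -
      have "K * (t * (norm a + norm b)) + K * (t * (norm a + norm b)) = K * (t * (2 * norm a + 2 * norm b))" for K
        by (simp add: algebra_simps)
      then show ?thesis using norm_triangle_ineq4[of R1 R2] R1 R2 by (smt (verit))
    qed
    also have "\<dots> \<le> e / ?c * (t * (2 * norm a + 2 * norm b + 1))"
      using e t by (intro mult_left_mono) auto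
    finally have R: "norm (R1 - R2) \<le> e / ?c * (t * (2 * norm a + 2 * norm b + 1))" .
    have "(g (x + t *\<^sub>R a + s *\<^sub>R b) - g (x + s *\<^sub>R b)) = t *\<^sub>R g' a + (R1 - R2)"
      by (simp add: R1_def R2_def linear_add[OF lin] linear_scale[OF lin])
    then have "(g (x + t *\<^sub>R a + s *\<^sub>R b) - g (x + s *\<^sub>R b)) \<bullet> b = t * (g' a \<bullet> b) + (R1 - R2) \<bullet> b"
      by (simp only: inner_add_left inner_scaleR_left)
    then have "\<phi> t - \<phi> 0 = t * (t * (g' a \<bullet> b) + (R1 - R2) \<bullet> b)"
      using s(3) by simp
    moreover have "\<phi> t - \<phi> 0 = f (x + t *\<^sub>R a + t *\<^sub>R b) - f (x + t *\<^sub>R a) - f (x + t *\<^sub>R b) + f x"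
      by (simp add: \<phi>_def)
    ultimately have eq: "(f (x + t *\<^sub>R a + t *\<^sub>R b) - f (x + t *\<^sub>R a) - f (x + t *\<^sub>R b) + f x) - t\<^sup>2 * (g' a \<bullet> b)
      = t * ((R1 - R2) \<bullet> b)"
      by (simp add: power2_eq_square distrib_left)
    have "\<bar>t * ((R1 - R2) \<bullet> b)\<bar> \<le> t * (norm (R1 - R2) * (norm b + 1))"
    proof -
      have "\<bar>(R1 - R2) \<bullet> b\<bar> \<le> norm (R1 - R2) * (norm b + 1)"
        by (rule order_trans[OF Cauchy_Schwarz_ineq2 mult_left_mono]) auto
      then show ?thesis using t by (simp add: abs_mult)
    qed
    also have "\<dots> \<le> t * (e / ?c * (t * (2 * norm a + 2 * norm b + 1)) * (norm b + 1))"
      using R t by (intro mult_left_mono mult_right_mono) auto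
    also have "\<dots> = e / ?c * ?c * t\<^sup>2" by (simp only: power2_eq_square mult_ac)
    also have "\<dots> = e * t\<^sup>2" by (subst nonzero_eq_divide_eq[THEN iffD1, OF less_imp_neq[OF c, symmetric] refl]) (rule refl)
    finally show "\<bar>(f (x + t *\<^sub>R a + t *\<^sub>R b) - f (x + t *\<^sub>R a) - f (x + t *\<^sub>R b) + f x) - t\<^sup>2 * (g' a \<bullet> b)\<bar> \<le> e * t\<^sup>2"
      using eq by simp
  qed
qed

text \<open>The second difference is symmetric in \<open>a\<close> and \<open>b\<close>, so its two
  leading coefficients differ by at most \<open>e\<close> for every positive
  \<open>e\<close>.\<close>

lemma symmetric_second_derivative_at:
  fixes f :: "'a::euclidean_space \<Rightarrow> real"
  assumes "open N" "x \<in> N"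
    and "\<And>y. y \<in> N \<Longrightarrow> (f has_derivative (\<lambda>h. g y \<bullet> h)) (at y)"
    and "(g has_derivative g') (at x)"
  shows "g' a \<bullet> b = g' b \<bullet> a"
proof -
  have "\<bar>g' a \<bullet> b - g' b \<bullet> a\<bar> \<le> e" if "e > 0" for e
  proof -
    have "0 < e / 2" using that by simp
    from second_difference_bound[OF assms this, of a b] second_difference_bound[OF assms this, of b a]
    obtain d1 d2 where d: "d1 > 0" "d2 > 0"
      and 1: "\<And>t. 0 < t \<Longrightarrow> t < d1 \<Longrightarrow> \<bar>(f (x + t *\<^sub>R a + t *\<^sub>R b) - f (x + t *\<^sub>R a) - f (x + t *\<^sub>R b) + f x) - t\<^sup>2 * (g' a \<bullet> b)\<bar> \<le> e/2 * t\<^sup>2"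
      and 2: "\<And>t. 0 < t \<Longrightarrow> t < d2 \<Longrightarrow> \<bar>(f (x + t *\<^sub>R b + t *\<^sub>R a) - f (x + t *\<^sub>R b) - f (x + t *\<^sub>R a) + f x) - t\<^sup>2 * (g' b \<bullet> a)\<bar> \<le> e/2 * t\<^sup>2"
      by metis
    define t where "t = min d1 d2 / 2"
    have t: "0 < t" "t < d1" "t < d2" using d by (auto simp: t_def)
    have "x + t *\<^sub>R b + t *\<^sub>R a = x + t *\<^sub>R a + t *\<^sub>R b" by simp
    then have "\<bar>t\<^sup>2 * (g' a \<bullet> b) - t\<^sup>2 * (g' b \<bullet> a)\<bar> \<le> e/2 * t\<^sup>2 + e/2 * t\<^sup>2"
      using 1[OF t(1,2)] 2[OF t(1,3)] by (simp only:)
    then have "t\<^sup>2 * \<bar>g' a \<bullet> b - g' b \<bullet> a\<bar> \<le> t\<^sup>2 * e"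
      by (simp add: abs_mult flip: right_diff_distrib) (simp add: mult.commute)
    then show ?thesis using t by simp
  qed
  then have "\<bar>g' a \<bullet> b - g' b \<bullet> a\<bar> \<le> 0" by (rule field_le_epsilon) simp
  then show ?thesis by simp
qed

section \<open>Orthonormal eigenbases of self-adjoint maps and symmetric matrices\<close>

text \<open>Near \<open>0\<close> the linear term dominates, so a nonzero \<open>a\<close> would
  produce a negative value on one side. This supplies the first-order condition at a maximum of the
  Rayleigh quotient.\<close>

lemma quadratic_nonneg_imp_linear_zero:
  fixes a b :: real
  assumes "\<And>t. 0 \<le> a * t + b * t\<^sup>2"
  shows "a = 0"
proof (rule ccontr)
  assume a: "a \<noteq> 0"
  define c where "c = \<bar>b\<bar> + 1"
  have c: "c > 0" "b < c" by (auto simp: c_def)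
  have "a * (- a / c) + b * (- a / c)\<^sup>2 = a\<^sup>2 / c * (b / c - 1)"
    using c by (simp add: field_simps power2_eq_square)
  also have "\<dots> < 0" using a c by (intro mult_pos_neg) auto
  finally show False using assms[of "- a / c"] by simp
qed

text \<open>The Rayleigh quotient attains its maximum \<open>M\<close> on the compact unit sphere of
  \<open>S\<close>. The form \<open>M * (y \<bullet> y) - y \<bullet> f y\<close> is then
  nonnegative on \<open>S\<close> and zero at \<open>v\<close>, so its first variation at
  \<open>v\<close> vanishes: \<open>M *\<^sub>R v - f v\<close> is orthogonal to
  \<open>S\<close>.\<close>

lemma self_adjoint_eigenvector:
  fixes f :: "'a::euclidean_space \<Rightarrow> 'a"
  assumes lin: "linear f" and sym: "\<And>x y. f x \<bullet> y = x \<bullet> f y"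
    and S: "subspace S" "f ` S \<subseteq> S" "S \<noteq> {0}"
  obtains v where "v \<in> S" "norm v = 1" "f v = (v \<bullet> f v) *\<^sub>R v"
proof -
  have lc: "continuous_on X f" for X
    using lin linear_continuous_on linear_conv_bounded_linear by blast
  obtain w where w: "w \<in> S" "w \<noteq> 0" using S subspace_0 by blast
  let ?K = "sphere 0 1 \<inter> S"
  have "compact ?K" using closed_subspace[OF S(1)] by (simp add: compact_Int_closed)
  moreover have "w /\<^sub>R norm w \<in> ?K" using w S by (auto simp: subspace_scale)
  moreover have "continuous_on ?K (\<lambda>y. y \<bullet> f y)" by (intro continuous_intros lc)
  ultimately obtain v where v: "v \<in> ?K" "\<And>y. y \<in> ?K \<Longrightarrow> y \<bullet> f y \<le> v \<bullet> f v"
    using continuous_attains_sup[of ?K "\<lambda>y. y \<bullet> f y"] by blast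
  define M where "M = v \<bullet> f v"
  have vv: "v \<bullet> v = 1" using v by (simp add: norm_eq_1)
  have Q: "0 \<le> M * (y \<bullet> y) - y \<bullet> f y" if "y \<in> S" for y
  proof (cases "y = 0")
    case False
    have "y /\<^sub>R norm y \<in> ?K" using that False S by (auto simp: subspace_scale)
    from v(2)[OF this] have "(y \<bullet> f y) / (y \<bullet> y) \<le> M"
      by (simp add: linear_scale[OF lin] M_def dot_square_norm power2_eq_square divide_simps)
    then show ?thesis using False by (simp add: divide_simps mult.commute)
  qed (simp add: linear_0[OF lin])
  have ort: "(M *\<^sub>R v - f v) \<bullet> y = 0" if y: "y \<in> S" for y
  proof -
    have "0 \<le> (2 * ((M *\<^sub>R v - f v) \<bullet> y)) * t + (M * (y \<bullet> y) - y \<bullet> f y) * t\<^sup>2" for t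
    proof -
      have "v + t *\<^sub>R y \<in> S" using v y S by (simp add: subspace_add subspace_scale)
      from Q[OF this] show ?thesis
        using vv by (simp add: linear_add[OF lin] linear_scale[OF lin] algebra_simps inner_commute
          power2_eq_square sym[of v y, symmetric] inner_simps M_def)
    qed
    from quadratic_nonneg_imp_linear_zero[OF this] show ?thesis by simp
  qed
  \<comment> \<open>Invariance of \<open>S\<close> puts the residual in \<open>S\<close>; being
    orthogonal to \<open>S\<close>, it is zero.\<close>
  have "M *\<^sub>R v - f v \<in> S" using v S by (auto intro!: subspace_diff subspace_scale)
  from ort[OF this] have "f v = M *\<^sub>R v" by simp
  then show ?thesis using that[of v] v by (simp add: M_def)
qed

text \<open>Induction on the dimension: the orthogonal complement of an eigenvector within
  \<open>S\<close> is again invariant, because \<open>f\<close> is self-adjoint.\<close>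

lemma self_adjoint_eigenbasis:
  fixes f :: "'a::euclidean_space \<Rightarrow> 'a"
  assumes lin: "linear f" and sym: "\<And>x y. f x \<bullet> y = x \<bullet> f y"
    and "subspace S" "f ` S \<subseteq> S"
  shows "\<exists>B\<subseteq>S. finite B \<and> card B = dim S \<and> (\<forall>v\<in>B. \<forall>w\<in>B. v \<bullet> w = (if v = w then 1 else 0))
    \<and> (\<forall>v\<in>B. f v = (v \<bullet> f v) *\<^sub>R v)"
  using assms(3,4)
proof (induction "dim S" arbitrary: S rule: less_induct)
  case less
  show ?case
  proof (cases "S = {0}")
    case True
    then show ?thesis by (intro exI[of _ "{}"]) auto
  next
    case False
    obtain v where v: "v \<in> S" "norm v = 1" "f v = (v \<bullet> f v) *\<^sub>R v"
      using self_adjoint_eigenvector[OF lin sym less.prems False] by blast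
    let ?S = "{y \<in> S. \<forall>x\<in>{v}. orthogonal x y}"
    have "?S = {y \<in> S. \<forall>x\<in>span {v}. orthogonal x y}"
      by (auto simp: span_singleton orthogonal_def dest: bspec[where x = v] bspec[where x = 1])
    then have "dim ?S + dim {v} = dim S"
      using dim_subspace_orthogonal_to_vectors[OF subspace_span[of "{v}"] less.prems(1)] v less.prems(1)
      by (simp add: span_minimal)
    moreover have "dim {v} = 1" using v by (subst dim_eq_card_independent) auto
    ultimately have d: "dim ?S + 1 = dim S" by simp
    have "subspace ?S" using less.prems
      by (auto simp: subspace_def orthogonal_def inner_simps)
    moreover have "f ` ?S \<subseteq> ?S"
    proof clarsimp
      fix y assume y: "y \<in> S" "orthogonal v y"
      have "v \<bullet> f y = f v \<bullet> y" by (simp add: sym)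
      also have "\<dots> = (v \<bullet> f v) * (v \<bullet> y)" by (subst v(3)) simp
      finally show "f y \<in> S \<and> orthogonal v (f y)" using y less.prems by (auto simp: orthogonal_def)
    qed
    ultimately obtain B where B: "B \<subseteq> ?S" "finite B" "card B = dim ?S"
      "\<forall>v\<in>B. \<forall>w\<in>B. v \<bullet> w = (if v = w then 1 else 0)" "\<forall>v\<in>B. f v = (v \<bullet> f v) *\<^sub>R v"
      using less.hyps[of ?S] d by auto
    have vv: "v \<bullet> v = 1" using v by (simp add: norm_eq_1)
    have "v \<notin> B" using B(1) vv by (auto simp: orthogonal_def)
    then show ?thesis
      using B v vv d by (intro exI[of _ "insert v B"])
        (auto simp: orthogonal_def inner_commute subset_iff)
  qed
qed

lemma symmetric_matrix_inner:
  fixes A :: "real^'n^'n"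
  assumes "transpose A = A"
  shows "(A *v x) \<bullet> y = x \<bullet> (A *v y)"
  by (metis assms dot_lmul_matrix vector_transpose_matrix)

lemma symmetric_matrix_eigenbasis:
  fixes A :: "real^'n^'n"
  assumes "transpose A = A"
  obtains v :: "'n \<Rightarrow> real^'n"
  where "\<And>j k. v j \<bullet> v k = (if j = k then 1 else 0)" "\<And>k. A *v v k = (v k \<bullet> (A *v v k)) *\<^sub>R v k"
proof -
  obtain B where B: "finite B" "card B = CARD('n)"
      "\<forall>v\<in>B. \<forall>w\<in>B. v \<bullet> w = (if v = w then 1 else 0)" "\<forall>v\<in>B. A *v v = (v \<bullet> (A *v v)) *\<^sub>R v"
    using self_adjoint_eigenbasis[OF matrix_vector_mul_linear[of A] symmetric_matrix_inner[OF assms], of UNIV]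
    by auto
  obtain v where "bij_betw v (UNIV :: 'n set) B"
    using B finite_same_card_bij[of "UNIV :: 'n set" B] by auto
  then show ?thesis using B that[of v] by (auto simp: bij_betw_def inj_on_def)
qed

text \<open>For the square matrix \<open>?Q\<close> with rows \<open>v k\<close>, a one-sided
  inverse is two-sided, and \<open>transpose ?Q ** ?Q = mat 1\<close> is the expansion.\<close>

lemma orthonormal_family_expand:
  fixes v :: "'n::finite \<Rightarrow> real^'n"
  assumes "\<And>j k. v j \<bullet> v k = (if j = k then 1 else 0)"
  shows "w = (\<Sum>k\<in>UNIV. (v k \<bullet> w) *\<^sub>R v k)"
proof -
  let ?Q = "\<chi> k. v k"
  have "?Q ** transpose ?Q = mat 1"
    using assms by (auto simp: matrix_matrix_mult_def transpose_def mat_def vec_eq_iff inner_vec_def)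
  then have "transpose ?Q ** ?Q = mat 1" by (simp add: matrix_left_right_inverse)
  then have "w = transpose ?Q *v (?Q *v w)" by (simp add: matrix_vector_mul_assoc)
  also have "\<dots> = (\<Sum>k\<in>UNIV. (v k \<bullet> w) *\<^sub>R v k)"
    by (simp add: matrix_vector_mult_def transpose_def vec_eq_iff inner_vec_def mult.commute)
  finally show ?thesis .
qed

text \<open>An eigenvector for \<open>c\<close> has components only along those \<open>v k\<close>
  with \<open>l k = c\<close>, so these form a basis of the eigenspace. Grouping the indices by the
  value of \<open>l\<close> turns multiplicities into a sum over indices.\<close>

lemma tr_arctan_eigenbasis:
  fixes A :: "real^'n^'n" and v :: "'n \<Rightarrow> real^'n"
  assumes sym: "transpose A = A"
    and v: "\<And>j k. v j \<bullet> v k = (if j = k then 1 else 0)" and eig: "\<And>k. A *v v k = l k *\<^sub>R v k"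
  shows "tr_arctan A = (\<Sum>k\<in>UNIV. arctan (l k))"
proof -
  have inj: "inj v" using v by (metis injI zero_neq_one)
  have nz: "v k \<noteq> 0" for k using v[of k k] by auto
  have coef: "l k = c" if "A *v w = c *\<^sub>R w" "v k \<bullet> w \<noteq> 0" for w c k
  proof -
    have "l k * (v k \<bullet> w) = (A *v v k) \<bullet> w" by (simp add: eig)
    also have "\<dots> = c * (v k \<bullet> w)" using that by (simp add: symmetric_matrix_inner[OF sym])
    finally show ?thesis using that by simp
  qed
  have ev: "{c. \<exists>w. w \<noteq> 0 \<and> A *v w = c *\<^sub>R w} = range l"
  proof safe
    fix c w assume w: "w \<noteq> 0" "A *v w = c *\<^sub>R w"
    have "\<exists>k. v k \<bullet> w \<noteq> 0"
    proof (rule ccontr)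
      assume "\<not> ?thesis"
      then show False using orthonormal_family_expand[OF v, of w] w(1) by simp
    qed
    then obtain k where "v k \<bullet> w \<noteq> 0" ..
    then show "c \<in> range l" using coef[OF w(2)] by blast
  qed (use nz eig in auto)
  have dim: "dim {w. A *v w = c *\<^sub>R w} = card {k. l k = c}" for c
  proof -
    have "{w. A *v w = c *\<^sub>R w} = span (v ` {k. l k = c})"
    proof safe
      fix w assume w: "A *v w = c *\<^sub>R w"
      have "(\<Sum>k\<in>UNIV. (v k \<bullet> w) *\<^sub>R v k) \<in> span (v ` {k. l k = c})"
      proof (rule span_sum)
        fix k
        show "(v k \<bullet> w) *\<^sub>R v k \<in> span (v ` {k. l k = c})"
          using coef[OF w, of k] by (cases "v k \<bullet> w = 0") (auto intro: span_scale span_base span_0)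
      qed
      then show "w \<in> span (v ` {k. l k = c})" using orthonormal_family_expand[OF v, of w] by simp
    next
      fix w assume "w \<in> span (v ` {k. l k = c})"
      then show "A *v w = c *\<^sub>R w"
        by (induction rule: span_induct)
          (auto simp: eig subspace_def matrix_vector_right_distrib matrix_vector_mult_scaleR algebra_simps)
    qed
    moreover have "independent (v ` {k. l k = c})"
    proof (rule pairwise_orthogonal_independent)
      show "pairwise orthogonal (v ` {k. l k = c})" using v by (auto simp: pairwise_def orthogonal_def)
    qed (use nz in force)
    ultimately show ?thesis
      using card_image[OF inj_on_subset[OF inj]] by (simp add: dim_eq_card_independent)
  qed
  have "tr_arctan A = (\<Sum>c\<in>range l. real (card {k. l k = c}) * arctan c)"
    unfolding tr_arctan_def dim ev ..
  also have "\<dots> = (\<Sum>c\<in>range l. \<Sum>k | l k = c. arctan (l k))" by simp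
  also have "\<dots> = (\<Sum>k\<in>UNIV. arctan (l k))"
    using sum.image_gen[of "UNIV :: 'n set" "\<lambda>k. arctan (l k)" l] by simp
  finally show ?thesis .
qed

section \<open>The determinant of 1 + iA and the function tr arctan\<close>

lemma symmetric_matrix_nth:
  assumes "transpose A = A"
  shows "A $ i $ j = A $ j $ i"
  using arg_cong[OF assms, of "\<lambda>M. M $ j $ i"] by (simp add: transpose_def)

definition of_real_mat :: "real^'m^'n \<Rightarrow> complex^'m^'n" where
  "of_real_mat A = (\<chi> i j. of_real (A $ i $ j))"

lemma of_real_mat_nth [simp]: "of_real_mat A $ i $ j = of_real (A $ i $ j)"
  by (simp add: of_real_mat_def)

lemma of_real_mat_mult: "of_real_mat (A ** B) = of_real_mat A ** of_real_mat B"
  by (simp add: of_real_mat_def matrix_matrix_mult_def vec_eq_iff)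

lemma of_real_mat_1: "of_real_mat (mat 1) = mat 1"
  by (simp add: of_real_mat_def mat_def vec_eq_iff)

lemma det_of_real_mat: "det (of_real_mat A) = of_real (det A)"
  by (simp add: det_def of_real_mat_def)

text \<open>For symmetric \<open>A\<close>, row \<open>j\<close> is the tangent vector
  \<open>graph_tangent A (axis j 1)\<close>, so the determinant is the value of
  \<open>dz_form\<close> on the coordinate basis.\<close>

definition one_plus_i :: "real^'n^'n \<Rightarrow> complex^'n^'n" where
  "one_plus_i A = (\<chi> i j. Complex (if i = j then 1 else 0) (A $ i $ j))"

lemma one_plus_i_eq: "one_plus_i A = mat 1 + (\<chi> i j. \<i> * of_real (A $ i $ j))"
  by (auto simp: one_plus_i_def mat_def vec_eq_iff complex_eq_iff)

lemma matrix_add_rdistrib: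
  fixes A B :: "'a::semiring_1^'m^'n" and C :: "'a^'p^'m"
  shows "(A + B) ** C = A ** C + B ** C"
  by (simp add: matrix_matrix_mult_def vec_eq_iff distrib_right sum.distrib)

text \<open>The cross terms cancel. The identity serves twice: for the modulus of the determinant,
  and to invert \<open>1 + iA\<close> when \<open>tr_arctan\<close> is differentiated.\<close>

lemma one_plus_i_mult_minus: "one_plus_i A ** one_plus_i (- A) = of_real_mat (mat 1 + A ** A)"
proof -
  let ?X = "\<lambda>A. (\<chi> i j. \<i> * of_real (A $ i $ j)) :: complex^'a^'a"
  have "?X A ** ?X (- A) = of_real_mat (A ** A)"
    by (simp add: vec_eq_iff matrix_matrix_mult_def mult_ac flip: sum_negf)
  moreover have "?X A + ?X (- A) = 0" by (simp add: vec_eq_iff)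
  ultimately have "(mat 1 + ?X A) ** (mat 1 + ?X (- A)) = mat 1 + of_real_mat (A ** A)"
    unfolding matrix_add_ldistrib matrix_add_rdistrib matrix_mul_lid matrix_mul_rid
    by (metis (no_types, lifting) add.assoc add.right_neutral)
  also have "\<dots> = of_real_mat (mat 1 + A ** A)"
    by (simp add: vec_eq_iff mat_def)
  finally show ?thesis by (simp only: one_plus_i_eq)
qed

lemma det_one_plus_i_minus: "det (one_plus_i (- A)) = cnj (det (one_plus_i A))"
proof -
  have "one_plus_i (- A) $ i $ j = cnj (one_plus_i A $ i $ j)" for i j
    by (simp add: one_plus_i_def complex_eq_iff)
  then show ?thesis by (simp add: det_def)
qed

text \<open>For real \<open>A\<close> the determinants of \<open>1 + iA\<close> and
  \<open>1 - iA\<close> are conjugate, so their product is the squared modulus.\<close>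

lemma norm_det_one_plus_i: "(cmod (det (one_plus_i A)))\<^sup>2 = det (mat 1 + A ** A)"
proof -
  have "complex_of_real ((cmod (det (one_plus_i A)))\<^sup>2) = det (one_plus_i A) * cnj (det (one_plus_i A))"
    by (rule complex_norm_square)
  also have "\<dots> = of_real (det (mat 1 + A ** A))"
    by (simp add: one_plus_i_mult_minus det_of_real_mat flip: det_one_plus_i_minus det_mul)
  finally show ?thesis by (simp only: of_real_eq_iff)
qed

text \<open>Polar form of one eigenvalue of \<open>1 + iA\<close>; this is where the arctangent
  enters.\<close>

lemma one_plus_i_tan: "1 + \<i> * of_real c = of_real (sqrt (1 + c\<^sup>2)) * exp (\<i> * of_real (arctan c))"
proof -
  have "sqrt (1 + c\<^sup>2) \<noteq> 0" by (simp add: add_nonneg_eq_0_iff)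
  then show ?thesis
    by (simp add: complex_eq_iff Re_exp Im_exp cos_arctan sin_arctan)
qed

text \<open>In an orthonormal eigenbasis the determinant is the product of the factors
  \<open>1 + \<i> * of_real (l k)\<close>; their moduli multiply to a positive number and their
  arguments add up to \<open>tr_arctan A\<close>.\<close>

lemma det_one_plus_i_polar:
  fixes A :: "real^'n^'n"
  assumes sym: "transpose A = A"
  shows "det (one_plus_i A) = of_real (cmod (det (one_plus_i A))) * exp (\<i> * of_real (tr_arctan A))"
    and "det (one_plus_i A) \<noteq> 0"
proof -
  obtain v :: "'n \<Rightarrow> real^'n" where v: "\<And>j k. v j \<bullet> v k = (if j = k then 1 else 0)"
    and eig: "\<And>k. A *v v k = (v k \<bullet> (A *v v k)) *\<^sub>R v k"
    using symmetric_matrix_eigenbasis[OF sym] by metis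
  define l where "l k = v k \<bullet> (A *v v k)" for k
  let ?Q = "\<chi> k. v k" let ?D = "(\<chi> j k. if j = k then 1 + \<i> * of_real (l j) else 0) :: complex^'n^'n"
  have Q: "?Q ** transpose ?Q = mat 1"
    using v by (auto simp: matrix_matrix_mult_def transpose_def mat_def vec_eq_iff inner_vec_def)
  have "(\<Sum>m\<in>UNIV. v k $ m * A $ m $ i) = l k * v k $ i" for k i
  proof -
    have "(A *v v k) $ i = l k * v k $ i" by (subst eig) (simp add: l_def)
    moreover have "A $ m $ i = A $ i $ m" for m by (rule symmetric_matrix_nth[OF sym])
    ultimately show ?thesis by (simp add: matrix_vector_mult_def mult.commute)
  qed
  then have cs: "(\<Sum>m\<in>UNIV. of_real (v k $ m) * of_real (A $ m $ i)) = complex_of_real (l k * v k $ i)" for k i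
    by (metis (mono_tags, lifting) of_real_mult of_real_sum sum.cong)
  have "of_real_mat ?Q ** (\<chi> i j. \<i> * of_real (A $ i $ j)) = (\<chi> k i. \<i> * of_real (l k * v k $ i))"
    unfolding cs[symmetric] by (simp add: matrix_matrix_mult_def vec_eq_iff sum_distrib_left mult_ac)
  moreover have "?D ** of_real_mat ?Q = (\<chi> k i. (1 + \<i> * of_real (l k)) * of_real (v k $ i))"
    by (simp add: matrix_matrix_mult_def vec_eq_iff if_distribR if_distrib[where f = "\<lambda>x. x * _"] sum.delta cong: if_cong)
  \<comment> \<open>Diagonalisation is stated as an intertwining relation, so that only
    \<open>det ?Q\<close> has to be cancelled.\<close>
  ultimately have "of_real_mat ?Q ** one_plus_i A = ?D ** of_real_mat ?Q"
    by (simp add: one_plus_i_eq matrix_add_ldistrib vec_eq_iff distrib_right mult.assoc)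
  from arg_cong[OF this, of det]
  have "det (of_real_mat ?Q) * det (one_plus_i A) = det ?D * det (of_real_mat ?Q)"
    by (simp only: det_mul)
  moreover have "det (of_real_mat ?Q) \<noteq> 0"
    using arg_cong[OF Q, of det] by (auto simp: det_mul det_of_real_mat)
  ultimately have "det (one_plus_i A) = det ?D" by simp
  also have "\<dots> = (\<Prod>k\<in>UNIV. 1 + \<i> * of_real (l k))"
    by (subst det_diagonal) auto
  also have "\<dots> = of_real (\<Prod>k\<in>UNIV. sqrt (1 + (l k)\<^sup>2)) * exp (\<i> * of_real (\<Sum>k\<in>UNIV. arctan (l k)))"
    by (simp add: one_plus_i_tan prod.distrib exp_sum sum_distrib_left)
  also have "(\<Sum>k\<in>UNIV. arctan (l k)) = tr_arctan A"
    using tr_arctan_eigenbasis[OF sym v, of l] eig by (simp add: l_def)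
  finally have eq: "det (one_plus_i A) = of_real (\<Prod>k\<in>UNIV. sqrt (1 + (l k)\<^sup>2)) * exp (\<i> * of_real (tr_arctan A))" .
  define r where "r = (\<Prod>k\<in>UNIV. sqrt (1 + (l k)\<^sup>2))"
  have "0 < r" unfolding r_def by (intro prod_pos) (simp add: add_pos_nonneg)
  moreover have "det (one_plus_i A) = of_real r * exp (\<i> * of_real (tr_arctan A))"
    unfolding r_def by (rule eq)
  ultimately show "det (one_plus_i A) = of_real (cmod (det (one_plus_i A))) * exp (\<i> * of_real (tr_arctan A))"
    and "det (one_plus_i A) \<noteq> 0" by (auto simp: norm_mult)
qed

text \<open>On a bounded set of symmetric matrices the graph of \<open>tr_arctan\<close> is a continuous image of the compact
  set of pairs of a matrix and an orthonormal eigenbasis. A function with compact graph is continuous.\<close>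

lemma continuous_on_tr_arctan:
  "continuous_on {A :: real^'n^'n. transpose A = A} tr_arctan"
proof -
  have local: "continuous_on {A :: real^'n^'n. transpose A = A \<and> A \<in> cball 0 R} tr_arctan" for R
  proof -
    let ?S = "{A :: real^'n^'n. transpose A = A \<and> A \<in> cball 0 R}"
    let ?K = "{(A, Q :: real^'n^'n). A \<in> ?S \<and> (\<forall>j k. Q $ j \<bullet> Q $ k = (if j = k then 1 else 0)) \<and>
        (\<forall>k. A *v (Q $ k) = (Q $ k \<bullet> (A *v (Q $ k))) *\<^sub>R (Q $ k))}"
    define F where "F = (\<lambda>(A :: real^'n^'n, Q :: real^'n^'n). (A, \<Sum>k\<in>UNIV. arctan (Q $ k \<bullet> (A *v (Q $ k)))))"
    have graph: "(\<lambda>A. (A, tr_arctan A)) ` ?S = F ` ?K"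
    proof (intro subset_antisym subsetI)
      fix z assume "z \<in> (\<lambda>A. (A, tr_arctan A)) ` ?S"
      then obtain A where A: "A \<in> ?S" "z = (A, tr_arctan A)" by auto
      then have sym: "transpose A = A" by simp
      obtain v :: "'n \<Rightarrow> real^'n" where v: "\<And>j k. v j \<bullet> v k = (if j = k then 1 else 0)"
        and eig: "\<And>k. A *v v k = (v k \<bullet> (A *v v k)) *\<^sub>R v k"
        using symmetric_matrix_eigenbasis[OF sym] by metis
      have "(A, \<chi> k. v k) \<in> ?K" using A v eig by simp
      moreover have "z = F (A, \<chi> k. v k)"
        using tr_arctan_eigenbasis[OF sym v eig] A by (simp add: F_def)
      ultimately show "z \<in> F ` ?K" by blast
    next
      fix z assume "z \<in> F ` ?K"
      then obtain A Q where AQ: "(A, Q) \<in> ?K" "z = F (A, Q)" by auto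
      have "tr_arctan A = (\<Sum>k\<in>UNIV. arctan (Q $ k \<bullet> (A *v (Q $ k))))"
        by (rule tr_arctan_eigenbasis[where v = "\<lambda>k. Q $ k"]) (use AQ in auto)
      then show "z \<in> (\<lambda>A. (A, tr_arctan A)) ` ?S" using AQ by (auto simp: F_def)
    qed
    have Qb: "norm Q \<le> real CARD('n)" if "\<forall>j k. Q $ j \<bullet> Q $ k = (if j = k then 1 else 0)" for Q :: "real^'n^'n"
    proof -
      have "norm Q \<le> (\<Sum>k\<in>UNIV. norm (Q $ k))" unfolding norm_vec_def by (rule L2_set_le_sum) simp
      also have "\<dots> = real CARD('n)" using that by (simp add: norm_eq_sqrt_inner)
      finally show ?thesis .
    qed
    have "bounded ?K"
    proof (rule bounded_subset)
      show "bounded (cball (0 :: real^'n^'n) R \<times> cball (0 :: real^'n^'n) (real CARD('n)))"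
        by (intro bounded_Times bounded_cball)
    qed (use Qb in auto)
    moreover have "closed ?K"
      unfolding case_prod_unfold mem_cball transpose_def matrix_vector_mult_def inner_vec_def mem_Collect_eq
      by (intro closed_Collect_conj closed_Collect_all closed_Collect_eq closed_Collect_le continuous_intros)
    ultimately have "compact ?K" by (simp add: compact_eq_bounded_closed)
    moreover have "continuous_on ?K F" unfolding F_def case_prod_unfold matrix_vector_mult_def inner_vec_def
      by (intro continuous_intros)
    ultimately have cl: "closed ((\<lambda>A. (A, tr_arctan A)) ` ?S)"
      unfolding graph by (intro compact_imp_closed compact_continuous_image)
    \<comment> \<open>The closed graph criterion asks for values in a compact set; the second
      projection of the image of \<open>?K\<close> provides one.\<close>
    then have "compact (snd ` (\<lambda>A. (A, tr_arctan A)) ` ?S)"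
      unfolding graph using \<open>compact ?K\<close> \<open>continuous_on ?K F\<close>
      by (intro compact_continuous_image continuous_intros) auto
    then show ?thesis
      by (rule continuous_from_closed_graph) (use cl in \<open>auto simp: image_image\<close>)
  qed
  show ?thesis
    unfolding continuous_on_eq_continuous_within
  proof
    fix A0 :: "real^'n^'n" assume A0: "A0 \<in> {A. transpose A = A}"
    \<comment> \<open>The ball of this radius is a neighbourhood of \<open>A0\<close>, so the
      bounded case gives continuity at \<open>A0\<close>.\<close>
    let ?R = "norm A0 + 1"
    have "at A0 within {A. transpose A = A} = at A0 within {A. transpose A = A \<and> A \<in> cball 0 ?R}"
      by (rule at_within_nhd[where S = "ball 0 ?R"]) auto
    then show "continuous (at A0 within {A. transpose A = A}) tr_arctan"
      using local[of ?R] A0 by (auto simp: continuous_on_eq_continuous_within continuous_within)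
  qed
qed

section \<open>Differentiation of determinants, of tr arctan and of orthonormal frames\<close>

text \<open>Jacobi's formula, from the product rule in the Leibniz expansion: at the identity matrix
  only the identity permutation contributes.\<close>

lemma has_derivative_det_at_identity:
  fixes N :: "'a::real_normed_vector \<Rightarrow> 'b::real_normed_field^'n^'n"
  assumes D: "\<And>i j. ((\<lambda>x. N x $ i $ j) has_derivative N' i j) (at x within S)" and N: "N x = mat 1"
  shows "((\<lambda>x. det (N x)) has_derivative (\<lambda>h. \<Sum>i\<in>UNIV. N' i i h)) (at x within S)"
proof -
  let ?D = "\<lambda>p h. of_int (sign p) * (\<Sum>i\<in>UNIV. N' i (p i) h * (\<Prod>j\<in>UNIV - {i}. N x $ j $ p j))"
  have *: "?D p h = (if p = id then \<Sum>i\<in>UNIV. N' i i h else 0)" if "p permutes UNIV" for p h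
  proof (cases "p = id")
    case True
    then show ?thesis by (simp add: N mat_def sign_id)
  next
    case False
    then obtain k where k: "p k \<noteq> k" by fastforce
    have "(\<Prod>j\<in>UNIV - {i}. N x $ j $ p j) = 0" for i
    proof -
      \<comment> \<open>\<open>p\<close> moves both \<open>k\<close> and \<open>p k\<close>, so
        omitting one index \<open>i\<close> leaves another moved index, and with it a zero
        off-diagonal entry.\<close>
      have "p (p k) \<noteq> p k" using k permutes_inj[OF that] by (auto dest: injD)
      then have "\<exists>j\<in>UNIV - {i}. p j \<noteq> j" using k by (cases "i = k") auto
      then obtain j where "j \<in> UNIV - {i}" "p j \<noteq> j" by blast
      then show ?thesis by (intro prod_zero) (auto simp: N mat_def intro!: bexI[of _ j])
    qed
    then show ?thesis using False by (simp only: mult_zero_right sum.neutral_const if_False)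
  qed
  have "((\<lambda>x. det (N x)) has_derivative (\<lambda>h. \<Sum>p | p permutes UNIV. ?D p h)) (at x within S)"
    unfolding det_def by (intro has_derivative_sum has_derivative_mult_right has_derivative_prod D)
  moreover have "(\<Sum>p | p permutes UNIV. ?D p h) = (\<Sum>i\<in>UNIV. N' i i h)" for h
    by (subst sum.cong[OF refl *]) (auto simp: permutes_id)
  ultimately show ?thesis by simp
qed

text \<open>Near \<open>x0\<close> the difference \<open>tr_arctan (A x) - tr_arctan (A x0)\<close> is the argument of
  \<open>z x = det ((1 + i A x) (1 - i A x0) P)\<close>, and \<open>z x0 = 1\<close>. Continuity selects the branch.\<close>

lemma tr_arctan_has_derivative:
  fixes A :: "'a::real_normed_vector \<Rightarrow> real^'n^'n"
  assumes S: "open S" "x0 \<in> S" and sym: "\<And>x. x \<in> S \<Longrightarrow> transpose (A x) = A x"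
    and D: "\<And>i j. ((\<lambda>x. A x $ i $ j) has_derivative A' i j) (at x0)"
    and P: "(mat 1 + A x0 ** A x0) ** P = mat 1"
  shows "((\<lambda>x. tr_arctan (A x)) has_derivative (\<lambda>h. \<Sum>i\<in>UNIV. \<Sum>j\<in>UNIV. A' i j h * P $ j $ i)) (at x0)"
proof -
  \<comment> \<open>\<open>K\<close> is the inverse of \<open>1 + i A x0\<close>, so the determinant
    below is differentiated at the identity matrix.\<close>
  define K where "K = one_plus_i (- A x0) ** of_real_mat P"
  define z where "z x = det (one_plus_i (A x) ** K)" for x
  have N0: "one_plus_i (A x0) ** K = mat 1"
    by (simp add: K_def matrix_mul_assoc one_plus_i_mult_minus P of_real_mat_1 flip: of_real_mat_mult)
  then have z0: "z x0 = 1" by (simp add: z_def)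
  \<comment> \<open>The derivative of \<open>z\<close> has the terms
    \<open>\<i> * of_real (A' i k h) * K $ k $ i\<close>; their imaginary parts see only the real
    part of \<open>K\<close>, which is \<open>P\<close>.\<close>
  have ReK: "Re (K $ k $ i) = P $ k $ i" for k i
  proof -
    have "Re (K $ k $ i) = (\<Sum>m\<in>UNIV. (if k = m then 1 else 0) * P $ m $ i)"
      by (simp add: K_def matrix_matrix_mult_def one_plus_i_def)
    then show ?thesis by (simp add: if_distrib[where f = "\<lambda>x. x * _"] cong: if_cong)
  qed
  have "((\<lambda>x. (one_plus_i (A x) ** K) $ i $ j) has_derivative
      (\<lambda>h. \<Sum>k\<in>UNIV. \<i> * of_real (A' i k h) * K $ k $ j)) (at x0)" for i j
  proof -
    have "((\<lambda>x. \<Sum>k\<in>UNIV. (of_real (if i = k then 1 else 0) + \<i> * of_real (A x $ i $ k)) * K $ k $ j) has_derivative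
      (\<lambda>h. \<Sum>k\<in>UNIV. \<i> * of_real (A' i k h) * K $ k $ j)) (at x0)"
      by (rule has_derivative_eq_rhs, (rule derivative_intros D)+) simp
    then show ?thesis by (simp add: one_plus_i_def matrix_matrix_mult_def Complex_eq)
  qed
  from has_derivative_det_at_identity[OF this N0]
  have Dz: "(z has_derivative (\<lambda>h. \<Sum>i\<in>UNIV. \<Sum>k\<in>UNIV. \<i> * of_real (A' i k h) * K $ k $ i)) (at x0)"
    by (simp add: z_def[abs_def])
  have "(Ln has_derivative (\<lambda>h. h)) (at (z x0))"
    using has_field_derivative_Ln[of 1] by (simp add: z0 has_field_derivative_def complex_nonpos_Reals_iff lambda_one)
  from has_derivative_Im[OF has_derivative_compose[OF Dz this]]
  have DL: "((\<lambda>x. tr_arctan (A x0) + Im (Ln (z x))) has_derivative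
      (\<lambda>h. \<Sum>i\<in>UNIV. \<Sum>j\<in>UNIV. A' i j h * P $ j $ i)) (at x0)"
    by (intro has_derivative_eq_rhs[OF has_derivative_add[OF has_derivative_const]]) (auto simp: ReK)
  have "(A \<longlongrightarrow> A x0) (at x0)"
    using has_derivative_continuous[OF D] by (auto intro!: vec_tendstoI simp: continuous_within)
  moreover have evS: "\<forall>\<^sub>F x in at x0. x \<in> S"
    using S by (intro eventually_at_in_open')
  ultimately have "((\<lambda>x. tr_arctan (A x)) \<longlongrightarrow> tr_arctan (A x0)) (at x0)"
    by (intro continuous_on_tendsto_compose[OF continuous_on_tr_arctan])
      (use sym S in \<open>auto elim: eventually_mono\<close>)
  then have "\<forall>\<^sub>F x in at x0. dist (tr_arctan (A x)) (tr_arctan (A x0)) < pi"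
    by (rule tendstoD) simp
  with evS have "\<forall>\<^sub>F x in at x0. tr_arctan (A x0) + Im (Ln (z x)) = tr_arctan (A x)"
  proof eventually_elim
    case (elim x)
    define r where "r x = cmod (det (one_plus_i (A x)))" for x
    have zx: "z x = of_real (r x) * exp (\<i> * of_real (tr_arctan (A x))) * det K" if "x \<in> S" for x
      unfolding z_def det_mul r_def using det_one_plus_i_polar(1)[OF sym[OF that]] by simp
    have r: "r x > 0" if "x \<in> S" for x
      using det_one_plus_i_polar(2)[OF sym[OF that]] by (simp add: r_def)
    \<comment> \<open>Cross-multiplication removes the common factor \<open>det K\<close>.\<close>
    have "z x * (of_real (r x0) * exp (\<i> * of_real (tr_arctan (A x0))))
        = of_real (r x) * exp (\<i> * of_real (tr_arctan (A x))) * z x0"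
      by (subst zx[OF elim(1)], subst zx[OF S(2)]) (simp only: mult_ac)
    then have "z x = of_real (r x / r x0) * exp (\<i> * of_real (tr_arctan (A x) - tr_arctan (A x0)))"
      using r[OF S(2)] by (simp add: z0 right_diff_distrib exp_diff field_simps)
    also have "\<dots> = exp (of_real (ln (r x / r x0)) + \<i> * of_real (tr_arctan (A x) - tr_arctan (A x0)))"
      using r[OF S(2)] r[OF elim(1)] by (simp add: exp_add exp_of_real flip: of_real_divide)
    \<comment> \<open>The bound by \<open>pi\<close> puts the exponent in the strip where
      \<open>Ln\<close> inverts \<open>exp\<close>.\<close>
    finally have "Ln (z x) = of_real (ln (r x / r x0)) + \<i> * of_real (tr_arctan (A x) - tr_arctan (A x0))"
      using elim(2) by (auto simp: dist_real_def intro!: Ln_exp[THEN subst])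
    then show ?case by simp
  qed
  from has_derivative_transform_eventually[OF DL this] show ?thesis by (simp add: z0)
qed

section \<open>Differentiability of determinants, linear solutions and orthonormal frames\<close>

lemma differentiable_det:
  fixes N :: "'a::real_normed_vector \<Rightarrow> 'b::real_normed_field^'n^'n"
  assumes "\<And>i j. (\<lambda>x. N x $ i $ j) differentiable (at x within S)"
  shows "(\<lambda>x. det (N x)) differentiable (at x within S)"
proof -
  have D: "((\<lambda>x. N x $ i $ j) has_derivative frechet_derivative (\<lambda>x. N x $ i $ j) (at x within S)) (at x within S)" for i j
    using assms[of i j] by (simp only: frechet_derivative_works)
  show ?thesis
    unfolding det_def
    by (rule differentiableI, (rule has_derivative_sum has_derivative_mult_right has_derivative_prod D)+)
qed

text \<open>Cramer's rule writes every entry of \<open>X\<close> as a quotient of determinants in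
  the entries of \<open>E\<close> and \<open>B\<close>. It later recovers differentiability of the
  Hessian from that of a frame.\<close>

lemma differentiable_linear_solve:
  fixes E X B :: "'a::real_normed_vector \<Rightarrow> real^'n^'n"
  assumes N: "open N" "x0 \<in> N"
    and eq: "\<And>x. x \<in> N \<Longrightarrow> E x ** X x = B x" and det: "\<And>x. x \<in> N \<Longrightarrow> det (E x) \<noteq> 0"
    and E: "\<And>i j. (\<lambda>x. E x $ i $ j) differentiable (at x0)"
    and B: "\<And>i j. (\<lambda>x. B x $ i $ j) differentiable (at x0)"
  shows "(\<lambda>x. X x $ i $ j) differentiable (at x0)"
proof -
  let ?f = "\<lambda>x. det (\<chi> k l. if l = i then B x $ k $ j else E x $ k $ l) / det (E x)"
  have "(\<lambda>x. (\<chi> k l. if l = i then B x $ k $ j else E x $ k $ l) $ k $ l) differentiable (at x0)" for k l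
    using E B by (cases "l = i") simp_all
  then have "?f differentiable (at x0)"
    using E det[OF N(2)] by (intro differentiable_divide differentiable_det)
  then obtain f' where f': "(?f has_derivative f') (at x0)" by (auto simp: differentiable_def)
  have "?f x = X x $ i $ j" if "x \<in> N" for x
  proof -
    have "E x *v column j (X x) = column j (B x)"
      by (simp add: eq[OF that, symmetric] matrix_matrix_mult_def matrix_vector_mult_def column_def vec_eq_iff)
    then have "column j (X x) = (\<chi> k. det (\<chi> i' j'. if j' = k then column j (B x) $ i' else E x $ i' $ j') / det (E x))"
      using cramer[OF det[OF that]] by blast
    then have "column j (X x) $ i = det (\<chi> i' j'. if j' = i then column j (B x) $ i' else E x $ i' $ j') / det (E x)"
      by simp
    then show ?thesis unfolding column_def vec_lambda_beta by (rule sym)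
  qed
  then have "((\<lambda>x. X x $ i $ j) has_derivative f') (at x0)"
    using has_derivative_transform_within_open[OF f' N] by auto
  then show ?thesis by (auto simp: differentiable_def)
qed

text \<open>Each induction step subtracts the projection onto the vectors already found and
  normalises. Independence keeps the remainder \<open>w\<close> nonzero, and the norm is
  differentiable away from zero.\<close>

lemma differentiable_gram_schmidt:
  fixes v :: "'k \<Rightarrow> 'a::real_normed_vector \<Rightarrow> 'b::real_inner"
  assumes "finite K" "x0 \<in> S"
    and "\<And>x k. x \<in> S \<Longrightarrow> k \<in> K \<Longrightarrow> v k x \<notin> span ((\<lambda>j. v j x) ` (K - {k}))"
    and "\<And>k. k \<in> K \<Longrightarrow> v k differentiable (at x0 within S)"
  shows "\<exists>e. (\<forall>x\<in>S. \<forall>j\<in>K. \<forall>k\<in>K. e j x \<bullet> e k x = (if j = k then 1 else 0))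
    \<and> (\<forall>x\<in>S. span ((\<lambda>k. e k x) ` K) = span ((\<lambda>k. v k x) ` K))
    \<and> (\<forall>k\<in>K. e k differentiable (at x0 within S))"
  using assms(1,3,4)
proof (induction K rule: finite_induct)
  case (insert a K)
  have "v k x \<notin> span ((\<lambda>j. v j x) ` (K - {k}))" if "x \<in> S" "k \<in> K" for x k
    using insert.prems(1)[OF that(1), of k] that span_mono[of "(\<lambda>j. v j x) ` (K - {k})" "(\<lambda>j. v j x) ` (insert a K - {k})"]
    by blast
  with insert obtain e where e: "\<forall>x\<in>S. \<forall>j\<in>K. \<forall>k\<in>K. e j x \<bullet> e k x = (if j = k then 1 else 0)"
    "\<forall>x\<in>S. span ((\<lambda>k. e k x) ` K) = span ((\<lambda>k. v k x) ` K)"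
    "\<forall>k\<in>K. e k differentiable (at x0 within S)"
    by fastforce
  define w where "w x = v a x - (\<Sum>k\<in>K. (v a x \<bullet> e k x) *\<^sub>R e k x)" for x
  define e' where "e' = e(a := (\<lambda>x. w x /\<^sub>R norm (w x)))"
  have e'K: "e' k = e k" if "k \<in> K" for k using that insert by (auto simp: e'_def)
  have e'a: "e' a x = w x /\<^sub>R norm (w x)" for x by (simp add: e'_def)
  have pr: "(\<Sum>k\<in>K. (v a x \<bullet> e k x) *\<^sub>R e k x) \<in> span ((\<lambda>k. e k x) ` K)" for x
    by (intro span_sum span_scale span_base) auto
  have wnz: "w x \<noteq> 0" if "x \<in> S" for x
  proof
    assume "w x = 0"
    then have "v a x \<in> span ((\<lambda>k. v k x) ` K)" using pr[of x] e(2) that by (simp add: w_def)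
    moreover have "insert a K - {a} = K" using insert by auto
    ultimately show False using insert.prems(1)[OF that, of a] by simp
  qed
  have wo: "w x \<bullet> e j x = 0" if "x \<in> S" "j \<in> K" for x j
  proof -
    have "(\<Sum>k\<in>K. (v a x \<bullet> e k x) * (e k x \<bullet> e j x)) = (\<Sum>k\<in>K. if k = j then v a x \<bullet> e k x else 0)"
      using that e(1) by (intro sum.cong) auto
    then show ?thesis
      using that insert.hyps(1) by (simp add: w_def inner_diff_left inner_sum_left)
  qed
  have "e' j x \<bullet> e' k x = (if j = k then 1 else 0)" if "x \<in> S" "j \<in> insert a K" "k \<in> insert a K" for x j k
  proof -
    have "w x \<bullet> w x = norm (w x) * norm (w x)" by (simp add: dot_square_norm power2_eq_square)
    then show ?thesis
      using that wnz[OF that(1)] wo[OF that(1)] e(1) insert.hyps(2)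
      by (auto simp: e'K e'a inner_commute) (simp add: field_simps)
  qed
  moreover have "span ((\<lambda>k. e' k x) ` insert a K) = span ((\<lambda>k. v k x) ` insert a K)" if x: "x \<in> S" for x
  proof -
    have im: "(\<lambda>k. e' k x) ` insert a K = insert (e' a x) ((\<lambda>k. e k x) ` K)" by (auto simp: e'K)
    have pr': "(\<Sum>k\<in>K. (v a x \<bullet> e k x) *\<^sub>R e k x) \<in> span (insert b ((\<lambda>k. e k x) ` K))" for b
      using pr[of x] span_mono[OF subset_insertI] by blast
    have "e' a x \<in> span (insert (v a x) ((\<lambda>k. e k x) ` K))"
      unfolding e'a w_def by (intro span_scale span_diff pr') (simp add: span_base)
    moreover have "v a x \<in> span (insert (e' a x) ((\<lambda>k. e k x) ` K))"
    proof -
      have "v a x = norm (w x) *\<^sub>R e' a x + (\<Sum>k\<in>K. (v a x \<bullet> e k x) *\<^sub>R e k x)"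
        using wnz[OF x] by (simp add: e'a w_def)
      also have "\<dots> \<in> span (insert (e' a x) ((\<lambda>k. e k x) ` K))"
        by (intro span_add span_scale pr') (simp add: span_base)
      finally show ?thesis .
    qed
    ultimately have "span (insert (e' a x) ((\<lambda>k. e k x) ` K)) = span (insert (v a x) ((\<lambda>k. e k x) ` K))"
      by (intro subset_antisym span_minimal subspace_span) (auto intro: span_base)
    also have "\<dots> = span (insert (v a x) ((\<lambda>k. v k x) ` K))"
      using e(2) x by (simp add: span_insert)
    finally show ?thesis using im by simp
  qed
  moreover have "e' k differentiable (at x0 within S)" if "k \<in> insert a K" for k
  proof (cases "k = a")
    case False
    then show ?thesis using that e(3) e'K by auto
  next
    case True
    have wd: "w differentiable (at x0 within S)"
      unfolding w_def[abs_def] using insert e(3)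
      by (intro differentiable_diff differentiable_sum differentiable_scaleR differentiable_inner) auto
    have nd: "(\<lambda>x. norm (w x)) differentiable (at x0 within S)"
      using differentiable_compose[of norm w x0 S] wd wnz[OF assms(2)] differentiable_norm_at by blast
    have "(\<lambda>x. inverse (norm (w x)) *\<^sub>R w x) differentiable (at x0 within S)"
      using wd nd wnz[OF assms(2)] by (intro differentiable_scaleR differentiable_inverse) auto
    then show ?thesis using True by (simp add: e'a[abs_def] e'_def)
  qed
  ultimately show ?case by (intro exI[of _ e']) blast
qed auto

section \<open>Tangent spaces of gradient graphs\<close>

lemma has_derivative_vec_componentwise:
  fixes f :: "'a::real_normed_vector \<Rightarrow> 'b::euclidean_space^'n"
  assumes "\<And>i. ((\<lambda>x. f x $ i) has_derivative (\<lambda>h. f' h $ i)) (at a within S)"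
  shows "(f has_derivative f') (at a within S)"
  unfolding has_derivative_componentwise_within[of f]
  using assms by (auto simp: Basis_vec_def inner_axis intro: has_derivative_inner_left)

lemma differentiable_vec_componentwise:
  fixes f :: "'a::real_normed_vector \<Rightarrow> 'b::euclidean_space^'n"
  assumes "\<And>i. (\<lambda>x. f x $ i) differentiable (at a within S)"
  shows "f differentiable (at a within S)"
proof -
  have "(f has_derivative (\<lambda>h. \<chi> i. frechet_derivative (\<lambda>x. f x $ i) (at a within S) h)) (at a within S)"
    using assms by (intro has_derivative_vec_componentwise) (simp add: frechet_derivative_works)
  then show ?thesis by (rule differentiableI)
qed

lemma differentiable_vec_nth:
  "f differentiable (at a within S) \<Longrightarrow> (\<lambda>x. f x $ i) differentiable (at a within S)"
  unfolding differentiable_def by (blast intro: bounded_linear.has_derivative[OF bounded_linear_vec_nth])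

lemma has_derivative_gradient:
  fixes f :: "real^'n \<Rightarrow> real"
  assumes "f differentiable (at x)"
  shows "(f has_derivative (\<lambda>h. gradient f x \<bullet> h)) (at x)"
proof -
  let ?D = "frechet_derivative f (at x)"
  have lin: "linear ?D" using assms by (rule linear_frechet_derivative)
  have "?D h = gradient f x \<bullet> h" for h
  proof -
    have "?D h = ?D (\<Sum>i\<in>UNIV. h $ i *\<^sub>R axis i 1)"
      using basis_expansion[of h] by (simp add: scalar_mult_eq_scaleR)
    also have "\<dots> = gradient f x \<bullet> h"
      by (simp add: linear_sum[OF lin] linear_scale[OF lin] gradient_def partial_def inner_vec_def mult.commute)
    finally show ?thesis .
  qed
  then have "?D = (\<lambda>h. gradient f x \<bullet> h)" by (rule ext)
  with assms show ?thesis by (simp only: frechet_derivative_works)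
qed

section \<open>Linear algebra of the Lagrangian subspace \<open>(1 + iA) v\<close>\<close>

text \<open>The vector \<open>(1 + iA) v\<close>; for the Hessian of \<open>u\<close> this is the
  derivative of \<open>graph_point u\<close> in the direction \<open>v\<close>.\<close>

definition graph_tangent :: "real^'n^'n \<Rightarrow> real^'n \<Rightarrow> complex^'n" where
  "graph_tangent A v = (\<chi> k. Complex (v $ k) ((A *v v) $ k))"

lemma inner_complex_vec: "z \<bullet> w = (\<Sum>k\<in>UNIV. Re (z $ k) * Re (w $ k)) + (\<Sum>k\<in>UNIV. Im (z $ k) * Im (w $ k))"
  for z w :: "complex^'n"
  by (simp add: inner_vec_def inner_complex_def sum.distrib)

lemma linear_graph_tangent: "linear (graph_tangent A)"
  by (rule linearI) (simp_all add: graph_tangent_def vec_eq_iff complex_eq_iff matrix_vector_right_distrib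
      matrix_vector_mult_scaleR)

lemma inner_graph_tangent: "graph_tangent A v \<bullet> graph_tangent A w = v \<bullet> w + (A *v v) \<bullet> (A *v w)"
  by (simp add: inner_complex_vec graph_tangent_def) (simp add: inner_vec_def)

lemma linear_re_part: "linear re_part"
  by (rule linearI) (simp_all add: re_part_def vec_eq_iff)

lemma re_part_graph_tangent [simp]: "re_part (graph_tangent A v) = v"
  by (simp add: re_part_def graph_tangent_def vec_eq_iff)

lemma re_part_graph_point [simp]: "re_part (graph_point u x) = x"
  by (simp add: re_part_def graph_point_def vec_eq_iff)

lemma inner_cJ: "cJ z \<bullet> w = - (z \<bullet> cJ w)"
  by (simp add: inner_complex_vec cJ_def sum_negf)

lemma inj_cJ: "cJ z = cJ w \<Longrightarrow> z = w"
  by (simp add: cJ_def vec_eq_iff)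

text \<open>The Lagrangian condition: the symplectic form vanishes on the subspace exactly by the
  symmetry of \<open>A\<close>.\<close>

lemma cJ_graph_tangent_orthogonal:
  assumes "transpose A = A"
  shows "graph_tangent A v \<bullet> cJ (graph_tangent A w) = 0"
proof -
  have "graph_tangent A v \<bullet> cJ (graph_tangent A w) = (A *v v) \<bullet> w - v \<bullet> (A *v w)"
    by (simp add: inner_complex_vec cJ_def graph_tangent_def sum_negf) (simp add: inner_vec_def)
  then show ?thesis using symmetric_matrix_inner[OF assms] by simp
qed

text \<open>For \<open>H = a + ib\<close>, orthogonality to all \<open>(1 + iA) v\<close> means
  \<open>a + Ab = 0\<close>; hence \<open>-JH = b - ia = (1 + iA) b\<close>.\<close>

lemma orthogonal_graph_tangent_imp_cJ:
  fixes H :: "complex^'n"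
  assumes sym: "transpose A = A" and H: "\<And>v. H \<bullet> graph_tangent A v = 0"
  shows "- cJ H \<in> range (graph_tangent A)"
proof -
  define b where "b = (\<chi> k. Im (H $ k))"
  have "(re_part H + A *v b) \<bullet> v = 0" for v
  proof -
    have "H \<bullet> graph_tangent A v = re_part H \<bullet> v + b \<bullet> (A *v v)"
      by (simp add: inner_complex_vec graph_tangent_def re_part_def b_def) (simp add: inner_vec_def)
    then show ?thesis using H[of v] by (simp add: symmetric_matrix_inner[OF sym] inner_add_left)
  qed
  from this[of "re_part H + A *v b"] have "re_part H + A *v b = 0" by (simp only: inner_eq_zero_iff)
  then have "re_part H $ k + (A *v b) $ k = 0" for k by (metis vector_add_component zero_index)
  then have "Re (H $ k) = - (A *v b) $ k" for k
    by (simp add: re_part_def eq_neg_iff_add_eq_0)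
  then have "- cJ H = graph_tangent A b"
    by (simp add: cJ_def graph_tangent_def vec_eq_iff complex_eq_iff b_def)
  then show ?thesis by blast
qed

text \<open>The Gram matrix of the frame is \<open>Em ** (mat 1 + A ** A) ** transpose Em\<close>.
  Its determinant gives the first claim, which fixes the volume; the second identifies the inverse
  of the induced metric, the weight in the derivative of \<open>tr_arctan\<close>.\<close>

lemma orthonormal_graph_tangent:
  fixes E :: "'n::finite \<Rightarrow> real^'n"
  assumes sym: "transpose A = A"
    and E: "\<And>j k. graph_tangent A (E j) \<bullet> graph_tangent A (E k) = (if j = k then 1 else 0)"
  defines "Em \<equiv> \<chi> k. E k"
  shows "(det Em)\<^sup>2 * det (mat 1 + A ** A) = 1"
    and "(mat 1 + A ** A) ** (transpose Em ** Em) = mat 1"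
proof -
  let ?G = "mat 1 + A ** A"
  have "(Em ** ?G ** transpose Em) $ j $ k = graph_tangent A (E j) \<bullet> graph_tangent A (E k)" for j k
  proof -
    have "(Em ** ?G ** transpose Em) $ j $ k = column k (?G ** transpose Em) \<bullet> E j"
      unfolding matrix_mul_assoc[symmetric]
      by (simp add: Em_def matrix_matrix_mult_def column_def inner_vec_def mult.commute)
    also have "column k (?G ** transpose Em) = ?G *v E k"
      by (simp add: Em_def matrix_matrix_mult_def matrix_vector_mult_def transpose_def column_def vec_eq_iff)
    finally have "(Em ** ?G ** transpose Em) $ j $ k = (?G *v E k) \<bullet> E j" .
    then show ?thesis
      by (simp add: inner_graph_tangent matrix_vector_mult_add_rdistrib inner_add_left inner_add_right inner_commute
         symmetric_matrix_inner[OF sym] flip: matrix_vector_mul_assoc)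
  qed
  then have 1: "Em ** ?G ** transpose Em = mat 1"
    using E by (simp add: vec_eq_iff mat_def)
  from arg_cong[OF this, of det] show "(det Em)\<^sup>2 * det ?G = 1"
    by (simp add: det_mul power2_eq_square mult_ac)
  have "transpose ?G = ?G"
    using sym by (simp add: transpose_def vec_eq_iff matrix_matrix_mult_def mat_def mult.commute)
  \<comment> \<open>A one-sided inverse is two-sided, so the last factor may move to the front;
    transposing then brings \<open>?G\<close> to the left.\<close>
  moreover have "transpose Em ** (Em ** ?G) = mat 1" using 1 by (simp add: matrix_left_right_inverse)
  then have "transpose (transpose Em ** (Em ** ?G)) = mat 1" by (simp add: transpose_mat)
  ultimately show "?G ** (transpose Em ** Em) = mat 1"
    by (simp add: matrix_transpose_mul matrix_mul_assoc)
qed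

lemma span_graph_tangent_axis: "span (range (\<lambda>k. graph_tangent A (axis k 1))) = range (graph_tangent A)"
proof
  show "span (range (\<lambda>k. graph_tangent A (axis k 1))) \<subseteq> range (graph_tangent A)"
    by (intro span_minimal linear_subspace_image linear_graph_tangent subspace_UNIV) auto
  show "range (graph_tangent A) \<subseteq> span (range (\<lambda>k. graph_tangent A (axis k 1)))"
  proof clarify
    fix v
    have "graph_tangent A v = graph_tangent A (\<Sum>i\<in>UNIV. v $ i *\<^sub>R axis i 1)"
      using basis_expansion[of v] by (simp add: scalar_mult_eq_scaleR)
    also have "\<dots> \<in> span (range (\<lambda>k. graph_tangent A (axis k 1)))"
      unfolding linear_sum[OF linear_graph_tangent] linear_scale[OF linear_graph_tangent]
      by (intro span_sum span_scale span_base) auto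
    finally show "graph_tangent A v \<in> span (range (\<lambda>k. graph_tangent A (axis k 1)))" .
  qed
qed

text \<open>The real part of the \<open>k\<close>-th coordinate vanishes on the span of the other
  vectors but not on this one.\<close>

lemma graph_tangent_axis_independent:
  "graph_tangent A (axis k 1) \<notin> span ((\<lambda>j. graph_tangent A (axis j 1)) ` (UNIV - {k}))"
proof
  assume k: "graph_tangent A (axis k 1) \<in> span ((\<lambda>j. graph_tangent A (axis j 1)) ` (UNIV - {k}))"
  let ?S = "{z. re_part z $ k = 0}"
  have "subspace ?S" by (auto simp: subspace_def re_part_def)
  moreover have "(\<lambda>j. graph_tangent A (axis j 1)) ` (UNIV - {k}) \<subseteq> ?S" by (auto simp: axis_def)
  ultimately have "graph_tangent A (axis k 1) \<in> ?S" using k span_minimal by blast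
  then show False by (simp add: axis_def)
qed

text \<open>The definite description is justified by the orthogonal decomposition: the difference of
  two candidates lies both in \<open>T\<close> and in its complement.\<close>

lemma normal_part:
  assumes "subspace T"
  shows "normal_part T w \<in> orthogonal_comp T" "w - normal_part T w \<in> T"
proof -
  have "\<exists>!y. y \<in> orthogonal_comp T \<and> w - y \<in> T"
  proof -
    obtain y z where yz: "y \<in> span T" "\<And>w. w \<in> span T \<Longrightarrow> orthogonal z w" "w = y + z"
      using orthogonal_subspace_decomp_exists[of T w] by metis
    have z: "z \<in> orthogonal_comp T \<and> w - z \<in> T"
      using yz assms by (auto simp: orthogonal_comp_def orthogonal_commute span_base span_eq_iff[THEN iffD2])
    have "z' = z" if "z' \<in> orthogonal_comp T \<and> w - z' \<in> T" for z'
    proof -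
      have "(w - z) - (w - z') \<in> T" using that z assms by (blast intro: subspace_diff)
      then have "z' - z \<in> T" by simp
      moreover have "z' - z \<in> orthogonal_comp T" using that z subspace_orthogonal_comp by (blast intro: subspace_diff)
      ultimately have "z' - z = 0" by (auto simp: orthogonal_comp_def orthogonal_self)
      then show ?thesis by simp
    qed
    with z show ?thesis by blast
  qed
  from theI'[OF this] show "normal_part T w \<in> orthogonal_comp T" "w - normal_part T w \<in> T"
    by (auto simp: normal_part_def)
qed

section \<open>The graph of the gradient of a C2 function\<close>

locale C2_potential =
  fixes u :: "real^'n::finite \<Rightarrow> real" and \<Omega> :: "(real^'n) set"
  assumes open_domain: "open \<Omega>" and C2: "C_k_on 2 u \<Omega>"
begin

lemma differentiable_potential:
  assumes "x \<in> \<Omega>"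
  shows "u differentiable (at x)" "partial i u differentiable (at x)"
  using assms C2 open_domain
  by (auto simp: numeral_2_eq_2 differentiable_on_eq_differentiable_at)

text \<open>Row \<open>i\<close> of \<open>hessian\<close> holds the derivatives in direction
  \<open>i\<close>, so the Jacobian of the gradient is its transpose. Symmetry is deduced from this
  form.\<close>

lemma has_derivative_gradient_transpose:
  assumes "x \<in> \<Omega>"
  shows "(gradient u has_derivative (\<lambda>h. transpose (hessian u x) *v h)) (at x)"
proof (rule has_derivative_vec_componentwise)
  fix i
  have "(partial i u has_derivative (\<lambda>h. gradient (partial i u) x \<bullet> h)) (at x)"
    by (intro has_derivative_gradient differentiable_potential assms)
  then show "((\<lambda>x. gradient u x $ i) has_derivative (\<lambda>h. (transpose (hessian u x) *v h) $ i)) (at x)"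
    by (simp add: gradient_def[abs_def] hessian_def transpose_def matrix_vector_mult_def inner_vec_def)
qed

lemma hessian_symmetric:
  assumes "x \<in> \<Omega>"
  shows "transpose (hessian u x) = hessian u x"
proof -
  have "(transpose (hessian u x) *v a) \<bullet> b = (transpose (hessian u x) *v b) \<bullet> a" for a b
    by (rule symmetric_second_derivative_at[OF open_domain assms has_derivative_gradient
          has_derivative_gradient_transpose[OF assms]])
      (rule differentiable_potential)
  from this[of "axis i 1" "axis j 1" for i j]
  show ?thesis
    by (simp add: inner_axis matrix_vector_mult_basis column_def vec_eq_iff transpose_def)
qed

lemma has_derivative_gradient_hessian:
  "x \<in> \<Omega> \<Longrightarrow> (gradient u has_derivative (\<lambda>h. hessian u x *v h)) (at x)"
  using has_derivative_gradient_transpose by (simp add: hessian_symmetric)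

lemma has_derivative_graph_point:
  assumes "x \<in> \<Omega>"
  shows "(graph_point u has_derivative graph_tangent (hessian u x)) (at x)"
proof (rule has_derivative_vec_componentwise)
  fix i
  have 1: "((\<lambda>x. gradient u x $ i) has_derivative (\<lambda>h. (hessian u x *v h) $ i)) (at x)"
    by (intro bounded_linear.has_derivative[OF bounded_linear_vec_nth] has_derivative_gradient_hessian assms)
  have 2: "((\<lambda>x. x $ i) has_derivative (\<lambda>h. h $ i)) (at x)"
    by (rule bounded_linear.has_derivative[OF bounded_linear_vec_nth has_derivative_ident])
  show "((\<lambda>x. graph_point u x $ i) has_derivative (\<lambda>h. graph_tangent (hessian u x) h $ i)) (at x)"
    unfolding graph_point_def graph_tangent_def vec_lambda_beta Complex_eq
    by (intro has_derivative_add has_derivative_mult_right has_derivative_of_real 1 2)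
qed

abbreviation L where "L \<equiv> gradient_graph u \<Omega>"

lemma graph_point_re_part: "q \<in> L \<Longrightarrow> graph_point u (re_part q) = q \<and> re_part q \<in> \<Omega>"
  by (auto simp: gradient_graph_def)

lemma has_derivative_re_part: "(re_part has_derivative re_part) F"
  by (rule bounded_linear_imp_has_derivative) (simp add: linear_re_part linear_conv_bounded_linear[symmetric])

text \<open>A derivative within the graph is not unique in normal directions; composed with
  \<open>graph_point u\<close> it becomes a derivative on an open set, where uniqueness
  holds.\<close>

lemma has_derivative_graph_point_within:
  assumes "x \<in> \<Omega>" "N \<subseteq> \<Omega>" "x \<in> N" "open N" "graph_point u ` N \<subseteq> M"
    and "(f has_derivative f') (at (graph_point u x) within M)"
  shows "((\<lambda>y. f (graph_point u y)) has_derivative (\<lambda>h. f' (graph_tangent (hessian u x) h))) (at x)"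
proof -
  have "(graph_point u has_derivative graph_tangent (hessian u x)) (at x within N)"
    using has_derivative_graph_point assms(1) has_derivative_at_withinI by blast
  from diff_chain_within[OF this has_derivative_subset[OF assms(6,5)]]
  show ?thesis by (simp only: o_def at_within_open[OF assms(3,4)])
qed

section \<open>Tangent spaces, orientation and the phase of the graph\<close>

text \<open>A curve in \<open>L\<close> is the lift of its own projection, so the chain rule puts
  its velocity in the range. Conversely, lifted line segments realise every vector of the
  range.\<close>

lemma tangent_space_graph:
  assumes "x \<in> \<Omega>"
  shows "tangent_space L (graph_point u x) = range (graph_tangent (hessian u x))"
proof (intro subset_antisym subsetI)
  fix v assume "v \<in> tangent_space L (graph_point u x)"
  then obtain \<gamma> \<epsilon> where \<gamma>: "0 < \<epsilon>" "\<gamma> 0 = graph_point u x" "\<And>t. t \<in> {-\<epsilon><..<\<epsilon>} \<Longrightarrow> \<gamma> t \<in> L"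
    and D: "(\<gamma> has_derivative (\<lambda>t. t *\<^sub>R v)) (at 0)"
    by (auto simp: tangent_space_def has_vector_derivative_def)
  have "((\<lambda>t. re_part (\<gamma> t)) has_derivative (\<lambda>t. re_part (t *\<^sub>R v))) (at 0)"
    by (rule has_derivative_compose[OF D has_derivative_re_part])
  moreover have "(graph_point u has_derivative graph_tangent (hessian u x)) (at (re_part (\<gamma> 0)))"
    using has_derivative_graph_point[OF assms] \<gamma>(2) by simp
  ultimately have "((\<lambda>t. graph_point u (re_part (\<gamma> t))) has_derivative
      (\<lambda>t. graph_tangent (hessian u x) (re_part (t *\<^sub>R v)))) (at 0)"
    by (rule has_derivative_compose)
  then have "(\<gamma> has_derivative (\<lambda>t. graph_tangent (hessian u x) (re_part (t *\<^sub>R v)))) (at 0)"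
    by (rule has_derivative_transform_within_open[of _ _ _ _ "{-\<epsilon><..<\<epsilon>}"])
      (use \<gamma> graph_point_re_part in auto)
  from has_derivative_unique[OF D this]
  have "1 *\<^sub>R v = graph_tangent (hessian u x) (re_part (1 *\<^sub>R v))" by meson
  then show "v \<in> range (graph_tangent (hessian u x))" by (metis rangeI scaleR_one)
next
  fix v assume "v \<in> range (graph_tangent (hessian u x))"
  then obtain w where w: "v = graph_tangent (hessian u x) w" by blast
  obtain d where d: "d > 0" "ball x d \<subseteq> \<Omega>" using open_domain assms openE by blast
  \<comment> \<open>This keeps the segment in the ball of radius \<open>d\<close>; the added one
    covers \<open>w = 0\<close>.\<close>
  define \<epsilon> where "\<epsilon> = d / (norm w + 1)"
  have w1: "0 < norm w + 1" by (simp add: add_nonneg_pos)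
  have "0 < \<epsilon>" using d w1 by (simp add: \<epsilon>_def)
  moreover have "graph_point u (x + t *\<^sub>R w) \<in> L" if "t \<in> {-\<epsilon><..<\<epsilon>}" for t
  proof -
    have "\<bar>t\<bar> * norm w \<le> \<bar>t\<bar> * (norm w + 1)" by (intro mult_left_mono) auto
    also have "\<dots> < d" using that w1 by (auto simp: \<epsilon>_def pos_less_divide_eq abs_less_iff field_simps)
    finally have "x + t *\<^sub>R w \<in> ball x d" by (simp add: dist_norm)
    then show ?thesis using d by (auto simp: gradient_graph_def)
  qed
  moreover have "((\<lambda>t. graph_point u (x + t *\<^sub>R w)) has_vector_derivative v) (at 0)"
  proof -
    have "((\<lambda>t. x + t *\<^sub>R w) has_derivative (\<lambda>t. t *\<^sub>R w)) (at 0)"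
      by (auto intro!: derivative_eq_intros)
    moreover have "(graph_point u has_derivative graph_tangent (hessian u x)) (at (x + 0 *\<^sub>R w))"
      using has_derivative_graph_point[OF assms] by simp
    ultimately have "((\<lambda>t. graph_point u (x + t *\<^sub>R w)) has_derivative (\<lambda>t. graph_tangent (hessian u x) (t *\<^sub>R w))) (at 0)"
      by (rule has_derivative_compose)
    then show ?thesis by (simp add: has_vector_derivative_def w linear_scale[OF linear_graph_tangent])
  qed
  ultimately show "v \<in> tangent_space L (graph_point u x)"
    unfolding tangent_space_def
    by (intro CollectI exI[of _ "\<lambda>t. graph_point u (x + t *\<^sub>R w)"] exI[of _ \<epsilon>]) auto
qed

text \<open>Gram-Schmidt, followed by a change of sign of one vector if the orientation is wrong.
  This makes the choice in \<open>volume_form\<close> meaningful.\<close>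

lemma oriented_orthonormal_frame_exists:
  assumes x: "x \<in> \<Omega>"
  shows "\<exists>e. orthonormal_frame (tangent_space L (graph_point u x)) e \<and> e \<in> graph_orientation u \<Omega> (graph_point u x)"
proof -
  let ?A = "hessian u x"
  have T: "tangent_space L (graph_point u x) = range (graph_tangent ?A)"
    by (rule tangent_space_graph[OF x])
  \<comment> \<open>The real parameter is a dummy: the fields are constant and the parameter set is
    a single point.\<close>
  obtain e0 :: "'n \<Rightarrow> real \<Rightarrow> complex^'n" where
    e0: "\<forall>x\<in>{0::real}. \<forall>j\<in>UNIV. \<forall>k\<in>UNIV. e0 j x \<bullet> e0 k x = (if j = k then 1 else 0)"
    "\<forall>x\<in>{0::real}. span ((\<lambda>k. e0 k x) ` UNIV) = span ((\<lambda>k. graph_tangent ?A (axis k 1)) ` UNIV)"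
    using differentiable_gram_schmidt[of "UNIV :: 'n set" 0 "{0::real}" "\<lambda>k _. graph_tangent ?A (axis k 1)",
        OF finite_class.finite_UNIV singletonI graph_tangent_axis_independent differentiable_const]
    by blast
  define e where "e k = e0 k 0" for k
  have e: "e j \<bullet> e k = (if j = k then 1 else 0)" "span (range e) = range (graph_tangent ?A)" for j k
    using e0 by (auto simp: e_def[abs_def] span_graph_tangent_axis)
  have eT: "e k \<in> range (graph_tangent ?A)" for k
    unfolding e(2)[symmetric] by (rule span_base[OF rangeI])
  let ?d = "\<lambda>e. det (\<chi> j. re_part (e j))"
  have "graph_tangent ?A (re_part (e k)) = e k" for k using eT[of k] by auto
  then have "(det (\<chi> k. re_part (e k)))\<^sup>2 * det (mat 1 + ?A ** ?A) = 1"
    using orthonormal_graph_tangent(1)[OF hessian_symmetric[OF x], of "\<lambda>k. re_part (e k)"] e(1) by simp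
  then have d: "?d e \<noteq> 0" by auto
  show ?thesis
  proof (cases "0 < ?d e")
    case True
    then show ?thesis using e eT by (intro exI[of _ e]) (auto simp: orthonormal_frame_def graph_orientation_def T)
  next
    case False
    obtain a :: 'n where True by blast
    define e' where "e' = e(a := - e a)"
    have "(\<chi> j. re_part (e' j)) = (\<chi> j. if j = a then (-1) *s re_part (e j) else re_part (e j))"
      by (auto simp: e'_def vec_eq_iff re_part_def)
    then have "?d e' = - ?d e"
      using det_row_mul[of a "-1" "\<lambda>j. re_part (e j)" "\<lambda>j. re_part (e j)"]
      by simp
    then have "0 < ?d e'" using False d by simp
    moreover have "e' j \<bullet> e' k = (if j = k then 1 else 0)" for j k using e(1) by (auto simp: e'_def)
    moreover have "span (range e') = span (range e)"
    proof (intro subset_antisym span_minimal subspace_span)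
      show "range e' \<subseteq> span (range e)" by (auto simp: e'_def intro: span_base span_neg)
      have "e k \<in> span (range e')" for k
      proof (cases "k = a")
        case True
        have "- e' a \<in> span (range e')" by (intro span_neg span_base) auto
        then show ?thesis using True by (simp add: e'_def)
      next
        case False
        have "e' k \<in> span (range e')" by (intro span_base) auto
        then show ?thesis using False by (simp add: e'_def)
      qed
      then show "range e \<subseteq> span (range e')" by auto
    qed
    ultimately show ?thesis using e(2) span_base[of _ "range e'"]
      by (intro exI[of _ e']) (auto simp: orthonormal_frame_def graph_orientation_def T)
  qed
qed

text \<open>In base coordinates the vectors \<open>v\<close> and the frame \<open>e\<close> have
  matrices \<open>W\<close> and \<open>E\<close>. The form \<open>dz\<close> gives
  \<open>det W\<close> times the determinant of \<open>1 + iA\<close>, of modulus \<open>m\<close>;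
  the volume form gives \<open>det W * (m\<^sup>2 * det E)\<close>, which is
  \<open>det W * m\<close>. Their quotient is the phase factor.\<close>

lemma phase_function_graph:
  "phase_function L (graph_orientation u \<Omega>) (graph_pullback (\<lambda>x. tr_arctan (hessian u x)))"
  unfolding phase_function_def
proof (intro ballI allI impI)
  fix p and v :: "'n \<Rightarrow> complex^'n"
  assume "p \<in> L" and v: "\<forall>j. v j \<in> tangent_space L p"
  then obtain x where x: "x \<in> \<Omega>" "p = graph_point u x" by (auto simp: gradient_graph_def)
  let ?A = "hessian u x"
  have sym: "transpose ?A = ?A" by (rule hessian_symmetric[OF x(1)])
  have T: "tangent_space L p = range (graph_tangent ?A)" using tangent_space_graph x by simp
  define W where "W = (\<chi> j. re_part (v j))"
  have vW: "v j = graph_tangent ?A (W $ j)" for j using spec[OF v, of j] T by (auto simp: W_def)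
  define e where "e = (SOME e. orthonormal_frame (tangent_space L p) e \<and> e \<in> graph_orientation u \<Omega> p)"
  have e: "orthonormal_frame (tangent_space L p) e" "e \<in> graph_orientation u \<Omega> p"
    using someI_ex[OF oriented_orthonormal_frame_exists[OF x(1)]] x(2) by (auto simp: e_def)
  define E where "E = (\<chi> j. re_part (e j))"
  have eE: "e j = graph_tangent ?A (E $ j)" for j
  proof -
    have "e j \<in> range (graph_tangent ?A)" using e(2) T by (auto simp: graph_orientation_def)
    then show ?thesis by (auto simp: E_def)
  qed
  have "0 < det (\<chi> j k. re_part (e j) $ k)" using e(2) by (simp add: graph_orientation_def)
  moreover have "(\<chi> j k. re_part (e j) $ k) = E" by (simp add: E_def vec_eq_iff)
  ultimately have Epos: "0 < det E" by simp
  define m where "m = cmod (det (one_plus_i ?A))"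
  have mpos: "0 < m" using det_one_plus_i_polar(2)[OF sym] by (simp add: m_def)
  have m2: "m\<^sup>2 = det (mat 1 + ?A ** ?A)" by (simp add: m_def norm_det_one_plus_i)
  have "(det (\<chi> k. E $ k))\<^sup>2 * det (mat 1 + ?A ** ?A) = 1"
    using e(1) by (intro orthonormal_graph_tangent(1)[OF sym]) (simp add: orthonormal_frame_def eE)
  then have "(det E * m)\<^sup>2 = 1" by (simp add: m2 power_mult_distrib)
  \<comment> \<open>The Gram identity determines \<open>det E\<close> up to sign; the orientation
    makes it positive.\<close>
  then have Em: "det E * m = 1" using Epos mpos by (simp add: power2_eq_1_iff) (smt (verit) mult_pos_pos)
  have "(\<chi> j k. v j \<bullet> e k) = W ** (mat 1 + ?A ** ?A) ** transpose E"
  proof -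
    have "v j \<bullet> e k = (W ** ((mat 1 + ?A ** ?A) ** transpose E)) $ j $ k" for j k
    proof -
      have "v j \<bullet> e k = W $ j \<bullet> ((mat 1 + ?A ** ?A) *v (E $ k))"
        by (simp add: vW eE inner_graph_tangent matrix_vector_mult_add_rdistrib inner_add_right
           symmetric_matrix_inner[OF sym] flip: matrix_vector_mul_assoc)
      also have "(mat 1 + ?A ** ?A) *v (E $ k) = column k ((mat 1 + ?A ** ?A) ** transpose E)"
        by (simp add: matrix_matrix_mult_def matrix_vector_mult_def transpose_def column_def vec_eq_iff)
      finally show ?thesis
        by (simp add: matrix_matrix_mult_def[of W] inner_vec_def column_def)
    qed
    then show ?thesis by (simp add: vec_eq_iff matrix_mul_assoc)
  qed
  then have "det (\<chi> j k. v j \<bullet> e k) = det W * (m\<^sup>2 * det E)"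
    by (simp add: det_mul m2)
  also have "m\<^sup>2 * det E = m" using Em by (simp add: power2_eq_square mult_ac)
  finally have vol: "volume_form (tangent_space L p) (graph_orientation u \<Omega> p) v = det W * m"
    by (simp add: volume_form_def e_def Let_def)
  have "(\<chi> j k. v j $ k) = of_real_mat W ** one_plus_i ?A"
  proof -
    have "(of_real_mat W ** one_plus_i ?A) $ j $ k = v j $ k" for j k
    proof -
      have "?A $ i $ k = ?A $ k $ i" for i by (rule symmetric_matrix_nth[OF sym])
      then show ?thesis
        by (simp add: matrix_matrix_mult_def one_plus_i_def vW graph_tangent_def matrix_vector_mult_def
            complex_eq_iff if_distrib[where f = "\<lambda>x. _ * x"] mult.commute cong: if_cong)
    qed
    then show ?thesis by (simp add: vec_eq_iff)
  qed
  then have "dz_form v = of_real (det W) * det (one_plus_i ?A)"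
    by (simp add: dz_form_def det_mul det_of_real_mat)
  also have "\<dots> = exp (\<i> * of_real (tr_arctan ?A)) * of_real (det W * m)"
    by (subst det_one_plus_i_polar(1)[OF sym]) (simp add: m_def)
  finally show "dz_form v = exp (\<i> * of_real (graph_pullback (\<lambda>x. tr_arctan (hessian u x)) p)) *
      of_real (volume_form (tangent_space L p) (graph_orientation u \<Omega> p) v)"
    unfolding vol by (simp add: graph_pullback_def x(2))
qed

text \<open>The derivative within \<open>L\<close> is prescribed also in normal directions; adding \<open>g \<bullet> (q - graph_point u (re_part q))\<close>,
  which vanishes on \<open>L\<close>, adjusts these.\<close>

lemma is_gradient_at_graph_pullback:
  assumes x: "x \<in> \<Omega>" and g: "g \<in> range (graph_tangent (hessian u x))"
    and f: "(f has_derivative (\<lambda>h. g \<bullet> graph_tangent (hessian u x) h)) (at x)"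
  shows "is_gradient_at L (graph_pullback f) (graph_point u x) g"
proof -
  let ?p = "graph_point u x"
  have re: "(re_part has_derivative re_part) (at ?p within L)" by (rule has_derivative_re_part)
  have 1: "((\<lambda>q. f (re_part q)) has_derivative (\<lambda>v. g \<bullet> graph_tangent (hessian u x) (re_part v))) (at ?p within L)"
    by (rule has_derivative_compose[OF re]) (use f in simp)
  have "((\<lambda>q. graph_point u (re_part q)) has_derivative (\<lambda>v. graph_tangent (hessian u x) (re_part v))) (at ?p within L)"
    by (rule has_derivative_compose[OF re]) (use has_derivative_graph_point[OF x] in simp)
  then have 2: "((\<lambda>q. g \<bullet> q - g \<bullet> graph_point u (re_part q)) has_derivative
      (\<lambda>v. g \<bullet> v - g \<bullet> graph_tangent (hessian u x) (re_part v))) (at ?p within L)"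
    by (intro has_derivative_diff has_derivative_inner_right has_derivative_ident)
  have "((\<lambda>q. f (re_part q) + (g \<bullet> q - g \<bullet> graph_point u (re_part q))) has_derivative (\<lambda>v. g \<bullet> v)) (at ?p within L)"
    using has_derivative_add[OF 1 2] by simp
  then have "(graph_pullback f has_derivative (\<lambda>v. g \<bullet> v)) (at ?p within L)"
    by (rule has_derivative_transform[rotated 2])
      (use x graph_point_re_part in \<open>auto simp: graph_pullback_def gradient_graph_def\<close>)
  then show ?thesis using g by (simp add: is_gradient_at_def tangent_space_graph[OF x])
qed

text \<open>Pulled back to \<Omega>, both gradients give the same derivative, so their difference is
  orthogonal to the tangent space in which it lies.\<close>

lemma is_gradient_at_graph_unique:
  assumes x: "x \<in> \<Omega>" and "is_gradient_at L f (graph_point u x) g" "is_gradient_at L f (graph_point u x) g'"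
  shows "g = g'"
proof -
  let ?T = "range (graph_tangent (hessian u x))"
  have D: "((\<lambda>y. f (graph_point u y)) has_derivative (\<lambda>h. a \<bullet> graph_tangent (hessian u x) h)) (at x)"
    if "is_gradient_at L f (graph_point u x) a" for a
    using that x open_domain
    by (intro has_derivative_graph_point_within[where N = \<Omega> and M = L]) (auto simp: is_gradient_at_def gradient_graph_def)
  have "(\<lambda>h. g \<bullet> graph_tangent (hessian u x) h) = (\<lambda>h. g' \<bullet> graph_tangent (hessian u x) h)"
    using D[OF assms(2)] D[OF assms(3)] by (rule has_derivative_unique)
  then have eq: "(g - g') \<bullet> graph_tangent (hessian u x) h = 0" for h
    by (simp add: inner_diff_left) meson
  have "subspace ?T" by (intro linear_subspace_image linear_graph_tangent subspace_UNIV)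
  then have "g - g' \<in> ?T"
    using assms by (intro subspace_diff) (auto simp: is_gradient_at_def tangent_space_graph[OF x])
  then have "(g - g') \<bullet> (g - g') = 0" using eq by (auto simp del: inner_eq_zero_iff)
  then show ?thesis by simp
qed

section \<open>Mean curvature of the graph and the gradient of the phase\<close>

text \<open>Expresses \<open>H\<close> through the base components \<open>E\<close> of an arbitrary
  admissible frame. As J maps tangent vectors to normal ones, the pairings with
  \<open>cJ (graph_tangent (hessian u x) h)\<close> ignore all tangential terms.\<close>

lemma mean_curvature_normal:
  assumes x: "x \<in> \<Omega>" and H: "is_mean_curvature_at L (graph_point u x) H"
  obtains E :: "'n \<Rightarrow> real^'n" and A' :: "'n \<Rightarrow> 'n \<Rightarrow> real^'n \<Rightarrow> real" where
    "\<And>j k. graph_tangent (hessian u x) (E j) \<bullet> graph_tangent (hessian u x) (E k) = (if j = k then 1 else 0)"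
    "\<And>i j. ((\<lambda>y. hessian u y $ i $ j) has_derivative A' i j) (at x)"
    "\<And>h. H \<bullet> graph_tangent (hessian u x) h = 0"
    "\<And>h. H \<bullet> cJ (graph_tangent (hessian u x) h) = (\<Sum>k\<in>UNIV. \<Sum>i\<in>UNIV. \<Sum>j\<in>UNIV. A' i j (E k) * E k $ j * h $ i)"
proof -
  let ?A = "hessian u x" and ?p = "graph_point u x"
  let ?T = "tangent_space L ?p"
  from H[unfolded is_mean_curvature_at_def] obtain U and e :: "'n \<Rightarrow> complex^'n \<Rightarrow> complex^'n"
    where "open U \<and> ?p \<in> U \<and> (\<forall>q\<in>L \<inter> U. orthonormal_frame (tangent_space L q) (\<lambda>k. e k q))
      \<and> (\<forall>k. e k differentiable (at ?p within L))
      \<and> H = (\<Sum>k\<in>UNIV. second_fundamental_form L ?p (e k ?p) (e k))"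
    by (elim exE) (rule that)
  then have U: "open U" "?p \<in> U"
    and fr: "\<And>q. q \<in> L \<inter> U \<Longrightarrow> orthonormal_frame (tangent_space L q) (\<lambda>k. e k q)"
    and de: "\<And>k. e k differentiable (at ?p within L)"
    and Hsum: "H = (\<Sum>k\<in>UNIV. second_fundamental_form L ?p (e k ?p) (e k))"
    by simp_all
  \<comment> \<open>The frame lives on an ambient neighbourhood of the point; over \<open>N\<close>
    it becomes a family of functions of the base point.\<close>
  define N where "N = \<Omega> \<inter> graph_point u -` U"
  have "continuous_on \<Omega> (graph_point u)"
    by (intro continuous_at_imp_continuous_on ballI has_derivative_continuous[OF has_derivative_graph_point])
  then have "open N" unfolding N_def by (rule continuous_open_preimage[OF _ open_domain U(1)])
  then have N: "open N" "x \<in> N" "N \<subseteq> \<Omega>"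
    using x U by (auto simp: N_def)
  have NL: "graph_point u ` N \<subseteq> L \<inter> U" by (auto simp: N_def gradient_graph_def)
  define f where "f k y = e k (graph_point u y)" for k y
  define E where "E k y = re_part (f k y)" for k y
  have fr': "orthonormal_frame (range (graph_tangent (hessian u y))) (\<lambda>k. f k y)" if "y \<in> N" for y
  proof -
    have "y \<in> \<Omega>" "graph_point u y \<in> L \<inter> U" using NL N(3) that by auto
    then show ?thesis using fr[of "graph_point u y"] by (simp add: f_def tangent_space_graph)
  qed
  have fE: "f k y = graph_tangent (hessian u y) (E k y)" if "y \<in> N" for k y
  proof -
    have "f k y \<in> range (graph_tangent (hessian u y))"
      using fr'[OF that] span_base[of "f k y" "range (\<lambda>k. f k y)"] by (auto simp: orthonormal_frame_def)
    then show ?thesis by (auto simp: E_def)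
  qed
  have ortho: "graph_tangent (hessian u y) (E j y) \<bullet> graph_tangent (hessian u y) (E k y) = (if j = k then 1 else 0)"
    if "y \<in> N" for j k y
    using fr'[OF that] by (simp add: orthonormal_frame_def fE[OF that])
  define D where "D k = frechet_derivative (e k) (at ?p within L)" for k
  have De: "(e k has_derivative D k) (at ?p within L)" for k
    using de by (simp add: D_def frechet_derivative_works)
  have Df: "(f k has_derivative (\<lambda>h. D k (graph_tangent ?A h))) (at x)" for k
    unfolding f_def[abs_def]
    by (rule has_derivative_graph_point_within[OF x N(3,2,1) _ De]) (use NL in blast)
  have nth: "((\<lambda>y. f k y $ j) has_derivative (\<lambda>h. D k (graph_tangent ?A h) $ j)) (at x)" for k j
    by (rule bounded_linear.has_derivative[OF bounded_linear_vec_nth Df])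
  define E' where "E' k h = re_part (D k (graph_tangent ?A h))" for k h
  have DE: "((\<lambda>y. E k y $ j) has_derivative (\<lambda>h. E' k h $ j)) (at x)" for k j
    using has_derivative_Re[OF nth[of k j]] by (simp add: E_def E'_def re_part_def)
  \<comment> \<open>The imaginary parts of the frame are the Hessian applied to the real parts. This
    is a linear system for the Hessian with invertible, differentiable coefficients.\<close>
  have hess: "(\<lambda>y. hessian u y $ i $ j) differentiable (at x)" for i j
  proof (rule differentiable_linear_solve[OF N(1,2)])
    fix y assume y: "y \<in> N"
    then have sym: "transpose (hessian u y) = hessian u y" using hessian_symmetric N by blast
    show "(\<chi> k j. E k y $ j) ** hessian u y = (\<chi> k j. Im (f k y $ j))"
      using symmetric_matrix_nth[OF sym]
      by (simp add: fE[OF y] graph_tangent_def matrix_matrix_mult_def matrix_vector_mult_def vec_eq_iff mult.commute)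
    show "det (\<chi> k j. E k y $ j) \<noteq> 0"
      using orthonormal_graph_tangent(1)[OF sym, of "\<lambda>k. E k y"] ortho[OF y] by auto
  next
    fix k l
    show "(\<lambda>y. (\<chi> k j. E k y $ j) $ k $ l) differentiable at x"
      using DE[of k l] by (auto simp: differentiable_def)
    show "(\<lambda>y. (\<chi> k j. Im (f k y $ j)) $ k $ l) differentiable at x"
      using has_derivative_Im[OF nth[of k l]] by (auto simp: differentiable_def)
  qed
  define A' where "A' i j = frechet_derivative (\<lambda>y. hessian u y $ i $ j) (at x)" for i j
  have DA: "((\<lambda>y. hessian u y $ i $ j) has_derivative A' i j) (at x)" for i j
    using hess by (simp add: A'_def frechet_derivative_works)
  have symx: "transpose ?A = ?A" by (rule hessian_symmetric[OF x])
  have sub: "subspace ?T"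
    unfolding tangent_space_graph[OF x] by (intro linear_subspace_image linear_graph_tangent subspace_UNIV)
  have DJ: "D k (graph_tangent ?A h) \<bullet> cJ (graph_tangent ?A w) = (\<Sum>i\<in>UNIV. \<Sum>j\<in>UNIV. A' i j h * E k x $ j * w $ i)"
    for k h w
  proof -
    define c where "c = (\<chi> i. \<Sum>j\<in>UNIV. A' i j h * E k x $ j)"
    have "((\<lambda>y. Complex (E k y $ i) (\<Sum>j\<in>UNIV. hessian u y $ i $ j * E k y $ j)) has_derivative
        (\<lambda>h. of_real (E' k h $ i) + \<i> * of_real (\<Sum>j\<in>UNIV. ?A $ i $ j * E' k h $ j + A' i j h * E k x $ j))) (at x)" for i
      unfolding Complex_eq
      by (intro has_derivative_add has_derivative_mult_right has_derivative_of_real has_derivative_sum has_derivative_mult DE DA)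
    moreover have "f k y $ i = Complex (E k y $ i) (\<Sum>j\<in>UNIV. hessian u y $ i $ j * E k y $ j)" if "y \<in> N" for i y
      by (simp add: fE[OF that] graph_tangent_def matrix_vector_mult_def)
    ultimately have "((\<lambda>y. f k y $ i) has_derivative
        (\<lambda>h. of_real (E' k h $ i) + \<i> * of_real (\<Sum>j\<in>UNIV. ?A $ i $ j * E' k h $ j + A' i j h * E k x $ j))) (at x)" for i
      using has_derivative_transform_within_open[OF _ N(1,2)] by (metis (no_types, lifting))
    from has_derivative_unique[OF nth this]
    have "D k (graph_tangent ?A h) $ i = of_real (E' k h $ i) + \<i> * of_real (\<Sum>j\<in>UNIV. ?A $ i $ j * E' k h $ j + A' i j h * E k x $ j)" for i
      by meson
    \<comment> \<open>The product rule for \<open>(1 + iA) E\<close> splits the derivative into a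
      tangent vector and a purely imaginary vector coming from the derivative of the
      Hessian.\<close>
    then have "D k (graph_tangent ?A h) = graph_tangent ?A (E' k h) + (\<chi> i. Complex 0 (c $ i))"
      by (simp add: vec_eq_iff complex_eq_iff graph_tangent_def matrix_vector_mult_def c_def sum.distrib)
    moreover have "(\<chi> i. Complex 0 (c $ i)) \<bullet> cJ (graph_tangent ?A w) = c \<bullet> w"
      by (simp add: inner_complex_vec cJ_def graph_tangent_def) (simp add: inner_vec_def)
    ultimately have "D k (graph_tangent ?A h) \<bullet> cJ (graph_tangent ?A w) = c \<bullet> w"
      by (simp add: inner_add_left cJ_graph_tangent_orthogonal[OF symx])
    then show ?thesis by (simp add: inner_vec_def c_def sum_distrib_right)
  qed
  have II: "second_fundamental_form L ?p (e k ?p) (e k) = normal_part ?T (D k (graph_tangent ?A (E k x)))" for k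
    using fE[OF N(2), of k] by (simp add: second_fundamental_form_def D_def f_def)
  have "second_fundamental_form L ?p (e k ?p) (e k) \<bullet> graph_tangent ?A h = 0" for k h
    using normal_part(1)[OF sub, of "D k (graph_tangent ?A (E k x))"]
    by (auto simp: II orthogonal_comp_def orthogonal_def tangent_space_graph[OF x] inner_commute)
  then have "H \<bullet> graph_tangent ?A h = 0" for h by (simp add: Hsum inner_sum_left)
  moreover have "second_fundamental_form L ?p (e k ?p) (e k) \<bullet> cJ (graph_tangent ?A h)
      = (\<Sum>i\<in>UNIV. \<Sum>j\<in>UNIV. A' i j (E k x) * E k x $ j * h $ i)" for k h
  proof -
    \<comment> \<open>Taking the normal part changes the derivative by a tangent vector, which is
      orthogonal to J of the tangent space.\<close>
    obtain t where "D k (graph_tangent ?A (E k x)) - second_fundamental_form L ?p (e k ?p) (e k) = graph_tangent ?A t"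
      using normal_part(2)[OF sub, of "D k (graph_tangent ?A (E k x))"] by (auto simp: II tangent_space_graph[OF x])
    then have "second_fundamental_form L ?p (e k ?p) (e k) = D k (graph_tangent ?A (E k x)) - graph_tangent ?A t"
      by (simp add: algebra_simps)
    then show ?thesis by (simp add: inner_diff_left cJ_graph_tangent_orthogonal[OF symx] DJ)
  qed
  then have "H \<bullet> cJ (graph_tangent ?A h) = (\<Sum>k\<in>UNIV. \<Sum>i\<in>UNIV. \<Sum>j\<in>UNIV. A' i j (E k x) * E k x $ j * h $ i)" for h
    by (simp add: Hsum inner_sum_left)
  ultimately show thesis using that[of "\<lambda>k. E k x" A'] ortho[OF N(2)] DA by blast
qed

text \<open>Column \<open>j\<close> of the Hessian is the gradient of \<open>partial j u\<close>, so
  the pointwise symmetry of second derivatives applies to that function.\<close>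

lemma hessian_derivative_symmetric:
  assumes x: "x \<in> \<Omega>" and DA: "\<And>i. ((\<lambda>y. hessian u y $ i $ j) has_derivative A' i) (at x)"
  shows "(\<Sum>i\<in>UNIV. A' i a * b $ i) = (\<Sum>i\<in>UNIV. A' i b * a $ i)"
proof -
  have "(gradient (partial j u) has_derivative (\<lambda>h. \<chi> i. A' i h)) (at x)"
    using DA by (intro has_derivative_vec_componentwise) (simp add: gradient_def hessian_def)
  from symmetric_second_derivative_at[OF open_domain x has_derivative_gradient this, of a b]
  have "(\<chi> i. A' i a) \<bullet> b = (\<chi> i. A' i b) \<bullet> a"
    using differentiable_potential(2) by blast
  then show ?thesis by (simp add: inner_vec_def)
qed

text \<open>Both sides are contractions of the derivative of the Hessian with the frame, differing
  only in which slot receives \<open>h\<close>; symmetry matches them. Normality of \<open>H\<close>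
  makes \<open>- cJ H\<close> tangent.\<close>

lemma mean_curvature_is_gradient:
  assumes x: "x \<in> \<Omega>" and H: "is_mean_curvature_at L (graph_point u x) H"
  shows "is_gradient_at L (graph_pullback (\<lambda>x. tr_arctan (hessian u x))) (graph_point u x) (- cJ H)"
proof -
  let ?A = "hessian u x"
  have sym: "transpose ?A = ?A" by (rule hessian_symmetric[OF x])
  obtain E :: "'n \<Rightarrow> real^'n" and A' where ortho: "\<And>j k. graph_tangent ?A (E j) \<bullet> graph_tangent ?A (E k) = (if j = k then 1 else 0)"
    and DA: "\<And>i j. ((\<lambda>y. hessian u y $ i $ j) has_derivative A' i j) (at x)"
    and normal: "\<And>h. H \<bullet> graph_tangent ?A h = 0"
    and HJ: "\<And>h. H \<bullet> cJ (graph_tangent ?A h) = (\<Sum>k\<in>UNIV. \<Sum>i\<in>UNIV. \<Sum>j\<in>UNIV. A' i j (E k) * E k $ j * h $ i)"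
    by (rule mean_curvature_normal[OF x H]) (rule that)
  let ?E = "\<chi> k. E k"
  have P: "(mat 1 + ?A ** ?A) ** (transpose ?E ** ?E) = mat 1"
    by (rule orthonormal_graph_tangent(2)[OF sym ortho])
  have D: "((\<lambda>y. tr_arctan (hessian u y)) has_derivative
      (\<lambda>h. \<Sum>i\<in>UNIV. \<Sum>j\<in>UNIV. A' i j h * (transpose ?E ** ?E) $ j $ i)) (at x)"
    by (rule tr_arctan_has_derivative[OF open_domain x hessian_symmetric DA P])
  have "(\<Sum>i\<in>UNIV. \<Sum>j\<in>UNIV. A' i j h * (transpose ?E ** ?E) $ j $ i) = - cJ H \<bullet> graph_tangent ?A h" for h
  proof -
    have "(\<Sum>i\<in>UNIV. \<Sum>j\<in>UNIV. A' i j h * (transpose ?E ** ?E) $ j $ i)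
        = (\<Sum>i\<in>UNIV. \<Sum>j\<in>UNIV. \<Sum>k\<in>UNIV. A' i j h * E k $ i * E k $ j)"
      by (simp add: matrix_matrix_mult_def transpose_def sum_distrib_left mult_ac)
    also have "\<dots> = (\<Sum>k\<in>UNIV. \<Sum>i\<in>UNIV. \<Sum>j\<in>UNIV. A' i j h * E k $ i * E k $ j)"
      by (subst (2) sum.swap, subst sum.swap) (rule refl)
    also have "\<dots> = (\<Sum>k\<in>UNIV. \<Sum>j\<in>UNIV. \<Sum>i\<in>UNIV. A' i j h * E k $ i * E k $ j)"
      by (intro sum.cong refl sum.swap)
    also have "\<dots> = (\<Sum>k\<in>UNIV. \<Sum>j\<in>UNIV. (\<Sum>i\<in>UNIV. A' i j h * E k $ i) * E k $ j)"
      by (simp add: sum_distrib_right)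
    \<comment> \<open>The direction of differentiation \<open>h\<close> changes places with the
      frame vector \<open>E k\<close> in the index \<open>i\<close>.\<close>
    also have "\<dots> = (\<Sum>k\<in>UNIV. \<Sum>j\<in>UNIV. (\<Sum>i\<in>UNIV. A' i j (E k) * h $ i) * E k $ j)"
      using hessian_derivative_symmetric[OF x DA] by (simp only:)
    also have "\<dots> = (\<Sum>k\<in>UNIV. \<Sum>j\<in>UNIV. \<Sum>i\<in>UNIV. A' i j (E k) * E k $ j * h $ i)"
      by (simp add: sum_distrib_left sum_distrib_right mult_ac)
    also have "\<dots> = (\<Sum>k\<in>UNIV. \<Sum>i\<in>UNIV. \<Sum>j\<in>UNIV. A' i j (E k) * E k $ j * h $ i)"
      by (intro sum.cong refl sum.swap)
    finally show ?thesis by (simp add: HJ inner_cJ)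
  qed
  with D have "((\<lambda>y. tr_arctan (hessian u y)) has_derivative (\<lambda>h. - cJ H \<bullet> graph_tangent ?A h)) (at x)"
    by (simp only:)
  then show ?thesis
    by (intro is_gradient_at_graph_pullback[OF x] orthogonal_graph_tangent_imp_cJ[OF sym normal])
qed

text \<open>Gram-Schmidt turns the coordinate tangent fields, differentiable at the point together
  with the Hessian, into an admissible frame.\<close>

lemma mean_curvature_exists:
  assumes x: "x \<in> \<Omega>" and D: "hessian u differentiable (at x)"
  shows "\<exists>H. is_mean_curvature_at L (graph_point u x) H"
proof -
  let ?p = "graph_point u x"
  \<comment> \<open>Composition with \<open>re_part\<close> extends the coordinate fields from
    \<open>L\<close> to the ambient space.\<close>
  define v where "v k q = graph_tangent (hessian u (re_part q)) (axis k 1)" for k q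
  have p: "?p \<in> L" using x by (auto simp: gradient_graph_def)
  have indep: "v k q \<notin> span ((\<lambda>j. v j q) ` (UNIV - {k}))" for k q
    unfolding v_def by (rule graph_tangent_axis_independent)
  have "v k differentiable (at ?p within L)" for k
  proof (rule differentiable_vec_componentwise)
    fix i
    obtain D' where D': "(hessian u has_derivative D') (at x)" using D by (auto simp: differentiable_def)
    have "((\<lambda>q. hessian u (re_part q)) has_derivative (\<lambda>v. D' (re_part v))) (at ?p within L)"
      by (rule has_derivative_compose[OF has_derivative_re_part]) (use D' in simp)
    then have "(\<lambda>q. hessian u (re_part q)) differentiable (at ?p within L)" by (rule differentiableI)
    then have "(\<lambda>q. hessian u (re_part q) $ i $ k) differentiable (at ?p within L)"
      by (intro differentiable_vec_nth)
    then obtain d where d: "((\<lambda>q. hessian u (re_part q) $ i $ k) has_derivative d) (at ?p within L)"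
      by (auto simp: differentiable_def)
    have "((\<lambda>q. of_real (axis k 1 $ i) + \<i> * of_real (hessian u (re_part q) $ i $ k)) has_derivative
      (\<lambda>v. 0 + \<i> * of_real (d v))) (at ?p within L)"
      by (intro has_derivative_add has_derivative_const has_derivative_mult_right has_derivative_of_real d)
    moreover have "v k q $ i = of_real (axis k 1 $ i) + \<i> * of_real (hessian u (re_part q) $ i $ k)" for q
      by (simp add: v_def graph_tangent_def matrix_vector_mult_basis column_def Complex_eq)
    ultimately show "(\<lambda>q. v k q $ i) differentiable (at ?p within L)" by (auto simp: differentiable_def)
  qed
  from differentiable_gram_schmidt[OF finite_class.finite_UNIV p indep this]
  obtain e :: "'n \<Rightarrow> complex^'n \<Rightarrow> complex^'n" where e: "\<forall>q\<in>L. \<forall>j\<in>UNIV. \<forall>k\<in>UNIV. e j q \<bullet> e k q = (if j = k then 1 else 0)"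
    "\<forall>q\<in>L. span ((\<lambda>k. e k q) ` UNIV) = span ((\<lambda>k. v k q) ` UNIV)"
    "\<forall>k\<in>UNIV. e k differentiable (at ?p within L)"
    by blast
  have "orthonormal_frame (tangent_space L q) (\<lambda>k. e k q)" if q: "q \<in> L" for q
  proof -
    have "tangent_space L q = range (graph_tangent (hessian u (re_part q)))"
      using graph_point_re_part[OF q] tangent_space_graph[of "re_part q"] by simp
    also have "\<dots> = span (range (\<lambda>k. e k q))"
      using e(2) q by (simp add: v_def span_graph_tangent_axis)
    finally show ?thesis using e(1) q by (simp add: orthonormal_frame_def)
  qed
  then show ?thesis
    unfolding is_mean_curvature_at_def using e(3) by (intro exI[of _ UNIV] exI[of _ e] exI) auto
qed

end

section \<open>The phase of a gradient graph and its mean curvature\<close>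

theorem corollaryA2:
  fixes \<Omega> :: "(real^'n::finite) set" and u :: "real^'n \<Rightarrow> real"
  assumes "open \<Omega>" and "connected \<Omega>" and "\<Omega> \<noteq> {}"
    and "C_k_on 2 u \<Omega>"
  shows "phase_function (gradient_graph u \<Omega>) (graph_orientation u \<Omega>)
           (graph_pullback (\<lambda>x. tr_arctan (hessian u x)))
    \<and> (\<forall>x\<in>\<Omega>. hessian u differentiable (at x) \<longrightarrow>
         (\<exists>!H. is_mean_curvature_at (gradient_graph u \<Omega>) (graph_point u x) H))
    \<and> (\<forall>p\<in>gradient_graph u \<Omega>. \<forall>H. is_mean_curvature_at (gradient_graph u \<Omega>) p H \<longrightarrow>
         is_gradient_at (gradient_graph u \<Omega>) (graph_pullback (\<lambda>x. tr_arctan (hessian u x))) p (- cJ H))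
    \<and> (\<forall>\<psi>. smooth_on \<psi> \<Omega> \<and> (\<forall>x\<in>\<Omega>. tr_arctan (hessian u x) = \<psi> x) \<longrightarrow>
         (\<forall>p\<in>gradient_graph u \<Omega>. \<forall>H. is_mean_curvature_at (gradient_graph u \<Omega>) p H \<longrightarrow>
            is_gradient_at (gradient_graph u \<Omega>) (graph_pullback \<psi>) p (- cJ H)))"
proof -
  interpret C2_potential u \<Omega> using assms by unfold_locales
  let ?\<theta> = "graph_pullback (\<lambda>x. tr_arctan (hessian u x))"
  have grad: "is_gradient_at L ?\<theta> p (- cJ H)" if "p \<in> L" "is_mean_curvature_at L p H" for p H
    using that mean_curvature_is_gradient by (auto simp: gradient_graph_def)
  have unique: "\<exists>!H. is_mean_curvature_at L (graph_point u x) H" if "x \<in> \<Omega>" "hessian u differentiable (at x)" for x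
  proof -
    \<comment> \<open>Independence of the frame comes from the gradient: \<open>- cJ H\<close> and
      \<open>- cJ H'\<close> are gradients of the same function, and J is injective.\<close>
    have "H = H'" if "is_mean_curvature_at L (graph_point u x) H" "is_mean_curvature_at L (graph_point u x) H'" for H H'
      using is_gradient_at_graph_unique[OF \<open>x \<in> \<Omega>\<close> mean_curvature_is_gradient mean_curvature_is_gradient]
        that \<open>x \<in> \<Omega>\<close> inj_cJ by fastforce
    then show ?thesis using mean_curvature_exists[OF that] by blast
  qed
  have "is_gradient_at L (graph_pullback \<psi>) p (- cJ H)"
    if \<psi>: "\<forall>x\<in>\<Omega>. tr_arctan (hessian u x) = \<psi> x" and p: "p \<in> L" and H: "is_mean_curvature_at L p H" for \<psi> p H
  proof -
    \<comment> \<open>The two functions agree on \<open>L\<close>, and the derivative within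
      \<open>L\<close> sees only those values.\<close>
    have "graph_pullback \<psi> q = ?\<theta> q" if "q \<in> L" for q
      using \<psi> graph_point_re_part[OF that] by (simp add: graph_pullback_def)
    then show ?thesis
      using grad[OF p H] p unfolding is_gradient_at_def by (auto intro: has_derivative_transform)
  qed
  then show ?thesis using phase_function_graph unique grad by blast
qed

end
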